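(* Let $S_1,\dots,S_n$ be subsets of $[n]$ with associated $n\times n$ matrix $\Sigma=[\sigma_{ij}]$ ($\sigma_{ij}=-1$ if $j\in S_i$, $+1$ otherwise), and let $D_1,\dots,D_n$ be subspaces of $\bigotimes_{j=1}^n\mathbb C^2$ with $\dim D_i^\perp=1$ for all $i$. If $\mathrm{per}(\Sigma)\neq 0$, then there is a nonzero product vector $\ket\psi=\ket{\psi_1}\otimes\cdots\otimes\ket{\psi_n}$ with $\ket\psi^{\Gamma(S_i)}\in D_i$ for all $i=1,\dots,n$.
   Context: $\mathrm{per}(\Sigma)=\sum_{\lambda\in\mathrm{Sym}(n)}\sigma_{1,\lambda(1)}\cdots\sigma_{n,\lambda(n)}$ is the permanent. For $S\subseteq[n]$, $\ket\psi^{\Gamma(S)}$ is obtained from $\ket\psi=\ket{\psi_1}\otimes\cdots\otimes\ket{\psi_n}$ by replacing $\ket{\psi_j}$ with its complex conjugate for each $j\in S$. $D^\perp$ is the orthogonal complement. *)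

theory Defs
  imports "HOL-Analysis.Analysis"
begin

text \<open>The n-qubit space (C^2)^{\<otimes> n}: qubits are indexed by a finite type 'n
 (so n = CARD('n)); computational basis states are indexed by subsets x of the
 qubits (x = set of qubits in state |1>).  A single-qubit vector is complex^2 with
 coordinate 1 = |0> and coordinate 2 = |1>.\<close>

type_synonym 'n qstate = "complex ^ ('n set)"

definition cinner :: "complex ^ 'k::finite \<Rightarrow> complex ^ 'k \<Rightarrow> complex" where
  "cinner v w = (\<Sum>x\<in>UNIV. cnj (v $ x) * w $ x)"

definition orth_compl :: "(complex ^ 'k::finite) set \<Rightarrow> (complex ^ 'k) set" where
  "orth_compl D = {w. \<forall>v\<in>D. cinner v w = 0}"

definition prod_vec :: "('n::finite \<Rightarrow> complex ^ 2) \<Rightarrow> 'n qstate" where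
  "prod_vec \<psi> = (\<chi> x. \<Prod>j\<in>UNIV. \<psi> j $ (if j \<in> x then 2 else 1))"

definition partial_conj :: "'n set \<Rightarrow> ('n \<Rightarrow> complex ^ 2) \<Rightarrow> ('n \<Rightarrow> complex ^ 2)" where
  "partial_conj S \<psi> = (\<lambda>j. if j \<in> S then (\<chi> k. cnj (\<psi> j $ k)) else \<psi> j)"

definition sign_matrix :: "('n \<Rightarrow> 'n set) \<Rightarrow> 'n \<Rightarrow> 'n \<Rightarrow> int" where
  "sign_matrix S i j = (if j \<in> S i then -1 else 1)"

definition permanent :: "('n::finite \<Rightarrow> 'n \<Rightarrow> int) \<Rightarrow> int" where
  "permanent M = (\<Sum>p | p permutes (UNIV::'n set). \<Prod>i\<in>UNIV. M i (p i))"

end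

theory Submission
  imports Defs
begin

text \<open>
  The functions \<open>f\<^sub>i(\<psi>) = \<langle>\<phi>\<^sub>i, \<psi>\<^bsup>\<Gamma>(S\<^sub>i)\<^esup>\<rangle>\<close>, with \<open>\<phi>\<^sub>i\<close> spanning the orthogonal complement of \<open>D\<^sub>i\<close>, are
  sections of line bundles with degrees \<open>\<sigma>\<^sub>i\<^sub>j\<close> over a product of \<open>n\<close> spheres, and the top Chern number
  of their direct sum is the permanent of \<open>\<sigma>\<close>. The Chern-Weil argument is carried out by hand
  on a cell of radii and angles mapping onto the product of spheres. Each bundle carries a family
  of 1-forms \<open>\<gamma>\<^sub>i\<^sup>m\<close> that starts at \<open>m = 0\<close> with a connection form; by Stokes the integral of
  \<open>d\<gamma>\<^sub>1 \<and> \<dots> \<and> d\<gamma>\<^sub>n\<close> does not depend on \<open>m\<close>, and for \<open>m = 0\<close> it is the permanent times the volume of the cell.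
  For \<open>m \<rightarrow> \<infinity>\<close> the form \<open>d\<gamma>\<^sub>i\<^sup>m\<close> decays exponentially wherever \<open>f\<^sub>i\<close> is bounded away from zero, so without a
  common zero of the \<open>f\<^sub>i\<close> the integral is 0.
\<close>

subsection \<open>Partial derivatives of trigonometric polynomials\<close>

definition pd :: "'k \<Rightarrow> (('k \<Rightarrow> real) \<Rightarrow> complex) \<Rightarrow> ('k \<Rightarrow> real) \<Rightarrow> complex" where
  "pd a f x = vector_derivative (\<lambda>s. f (x(a := s))) (at (x a))"

lemma pd_eqI:
  "((\<lambda>s. f (x(a := s))) has_vector_derivative D) (at (x a)) \<Longrightarrow> pd a f x = D"
  unfolding pd_def by (rule vector_derivative_at)

text \<open>The coordinate \<open>(j, False)\<close> is a radius in \<open>[0, 1]\<close> and \<open>(j, True)\<close> an angle in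
  \<open>[0, 2\<pi>]\<close>. Only integer frequencies are allowed, so these functions are periodic in the angles.\<close>

inductive trigpoly :: "(('n \<times> bool \<Rightarrow> real) \<Rightarrow> complex) \<Rightarrow> bool" where
  const: "trigpoly (\<lambda>x. c)"
| radius: "trigpoly (\<lambda>x. of_real (x (j, False)))"
| angle: "trigpoly (\<lambda>x. cis (of_int k * x (j, True)))"
| add: "trigpoly f \<Longrightarrow> trigpoly g \<Longrightarrow> trigpoly (\<lambda>x. f x + g x)"
| mult: "trigpoly f \<Longrightarrow> trigpoly g \<Longrightarrow> trigpoly (\<lambda>x. f x * g x)"

lemma has_vector_derivative_cis_mult:
  "((\<lambda>s. cis (c * s)) has_vector_derivative \<i> * of_real c * cis (c * t)) (at t)"
proof -
  have "((\<lambda>s. c * s) has_real_derivative c) (at t)"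
    by (auto intro!: derivative_eq_intros)
  from has_vector_derivative_of_real[OF this]
  have "((\<lambda>s. complex_of_real (c * s)) has_vector_derivative of_real c) (at t)" .
  moreover have "((\<lambda>z. exp (z * \<i>)) has_field_derivative
      \<i> * exp (complex_of_real (c * t) * \<i>)) (at (complex_of_real (c * t)))"
    by (auto intro!: derivative_eq_intros)
  ultimately have "((\<lambda>s. exp (complex_of_real (c * s) * \<i>)) has_vector_derivative
      of_real c * (\<i> * exp (complex_of_real (c * t) * \<i>))) (at t)"
    by (auto dest: field_vector_diff_chain_at simp: o_def)
  then show ?thesis
    by (simp add: cis_conv_exp mult_ac)
qed

text \<open>\<open>pd\<close> is meaningful only where the derivative exists, so closure under
  \<open>pd\<close> and differentiability go through one induction. The auxiliary fact
  \<open>I\<close> reduces each case to exhibiting a trigonometric polynomial that is the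
  derivative.\<close>

lemma trigpoly_pd_aux:
  assumes "trigpoly f"
  shows "trigpoly (pd a f) \<and>
    (\<forall>x. ((\<lambda>s. f (x(a := s))) has_vector_derivative pd a f x) (at (x a)))"
proof -
  have I: "trigpoly (pd a f) \<and>
      (\<forall>x. ((\<lambda>s. f (x(a := s))) has_vector_derivative pd a f x) (at (x a)))"
    if "trigpoly D"
      and "\<And>x. ((\<lambda>s. f (x(a := s))) has_vector_derivative D x) (at (x a))" for f D
  proof -
    have "pd a f = D"
      by (rule ext, rule pd_eqI, rule that(2))
    with that show ?thesis
      by simp
  qed
  from assms show ?thesis
  proof (induction rule: trigpoly.induct)
    case (const c)
    show ?case
      by (rule I[of "\<lambda>x. 0"]) (auto intro: trigpoly.const)
  next
    case (radius j)
    show ?case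
    proof (rule I)
      show "trigpoly (\<lambda>x. if a = (j, False) then 1 else 0)"
        by (rule trigpoly.const)
      show "((\<lambda>s. complex_of_real ((x(a := s)) (j, False))) has_vector_derivative
          (if a = (j, False) then 1 else 0)) (at (x a))" for x
        using has_vector_derivative_of_real[OF DERIV_ident[of "at (x a)"]]
        by auto
    qed
  next
    case (angle k j)
    show ?case
    proof (rule I)
      show "trigpoly (\<lambda>x. (if a = (j, True) then \<i> * of_int k else 0) * cis (of_int k * x (j, True)))"
        by (intro trigpoly.intros)
      show "((\<lambda>s. cis (of_int k * (x(a := s)) (j, True))) has_vector_derivative
          (if a = (j, True) then \<i> * of_int k else 0) * cis (of_int k * x (j, True))) (at (x a))" for x
        using has_vector_derivative_cis_mult[of "of_int k"] by auto
    qed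
  next
    case (add f g)
    show ?case
    proof (rule I)
      show "trigpoly (\<lambda>x. pd a f x + pd a g x)"
        using add by (auto intro: trigpoly.add)
      show "((\<lambda>s. f (x(a := s)) + g (x(a := s))) has_vector_derivative
          pd a f x + pd a g x) (at (x a))" for x
        by (rule has_vector_derivative_add[OF add.IH(1)[THEN conjunct2, rule_format]
              add.IH(2)[THEN conjunct2, rule_format]])
    qed
  next
    case (mult f g)
    show ?case
    proof (rule I)
      show "trigpoly (\<lambda>x. f x * pd a g x + pd a f x * g x)"
        using mult by (auto intro!: trigpoly.add trigpoly.mult)
      show "((\<lambda>s. f (x(a := s)) * g (x(a := s))) has_vector_derivative
          f x * pd a g x + pd a f x * g x) (at (x a))" for x
        using has_vector_derivative_mult[OF mult.IH(1)[THEN conjunct2, rule_format, of x]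
            mult.IH(2)[THEN conjunct2, rule_format, of x]]
        by simp
    qed
  qed
qed

lemma trigpoly_pd: "trigpoly f \<Longrightarrow> trigpoly (pd a f)"
  and trigpoly_has_pd: "trigpoly f \<Longrightarrow>
    ((\<lambda>s. f (x(a := s))) has_vector_derivative pd a f x) (at (x a))"
  using trigpoly_pd_aux by blast+

lemma trigpoly_has_pd_at:
  assumes "trigpoly f"
  shows "((\<lambda>s. f (x(a := s))) has_vector_derivative pd a f (x(a := t))) (at t)"
  using trigpoly_has_pd[OF assms, of "x(a := t)" a] by simp

lemma trigpoly_sum: "(\<And>i. i \<in> A \<Longrightarrow> trigpoly (f i)) \<Longrightarrow> trigpoly (\<lambda>x. \<Sum>i\<in>A. f i x)"
  by (induction A rule: infinite_finite_induct) (auto intro: trigpoly.intros)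

lemma trigpoly_prod: "(\<And>i. i \<in> A \<Longrightarrow> trigpoly (f i)) \<Longrightarrow> trigpoly (\<lambda>x. \<Prod>i\<in>A. f i x)"
  by (induction A rule: infinite_finite_induct) (auto intro: trigpoly.intros)

lemma trigpoly_power: "trigpoly f \<Longrightarrow> trigpoly (\<lambda>x. f x ^ m)"
  by (induction m) (auto intro: trigpoly.intros)

lemma trigpoly_diff: "trigpoly f \<Longrightarrow> trigpoly g \<Longrightarrow> trigpoly (\<lambda>x. f x - g x)"
  using trigpoly.add[OF _ trigpoly.mult[OF trigpoly.const[of "-1"]], of f g] by simp

lemma trigpoly_cnj: "trigpoly f \<Longrightarrow> trigpoly (\<lambda>x. cnj (f x))"
proof (induction rule: trigpoly.induct)
  case (angle k j)
  show ?case
    using trigpoly.angle[of "- k" j] by (simp add: cis_cnj)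
qed (auto intro: trigpoly.intros)

lemmas trigpoly_intros =
  trigpoly.const trigpoly.radius trigpoly.angle trigpoly.add trigpoly.mult trigpoly_pd
  trigpoly_sum trigpoly_prod trigpoly_power trigpoly_diff trigpoly_cnj

lemma pd_const [simp]: "pd a (\<lambda>x. c) x = 0"
  by (rule pd_eqI) simp

lemma pd_radius: "pd a (\<lambda>x. of_real (x b)) x = (if a = b then 1 else 0)"
  by (rule pd_eqI) (use has_vector_derivative_of_real[OF DERIV_ident[of "at (x a)"]] in auto)

lemma pd_cis: "pd a (\<lambda>x. cis (c * x b)) x = (if a = b then \<i> * of_real c * cis (c * x b) else 0)"
  by (rule pd_eqI) (use has_vector_derivative_cis_mult in auto)

lemma pd_add:
  "trigpoly f \<Longrightarrow> trigpoly g \<Longrightarrow> pd a (\<lambda>x. f x + g x) x = pd a f x + pd a g x"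
  by (rule pd_eqI) (intro has_vector_derivative_add trigpoly_has_pd)

lemma pd_mult:
  assumes "trigpoly f" "trigpoly g"
  shows "pd a (\<lambda>x. f x * g x) x = f x * pd a g x + pd a f x * g x"
  by (rule pd_eqI)
    (use has_vector_derivative_mult[OF trigpoly_has_pd[OF assms(1), of x a] trigpoly_has_pd[OF assms(2), of x a]] in simp)

lemma pd_cmult: "trigpoly f \<Longrightarrow> pd a (\<lambda>x. c * f x) x = c * pd a f x"
  by (simp add: pd_mult trigpoly.const)

lemma pd_diff:
  "trigpoly f \<Longrightarrow> trigpoly g \<Longrightarrow> pd a (\<lambda>x. f x - g x) x = pd a f x - pd a g x"
  by (rule pd_eqI) (intro has_vector_derivative_diff trigpoly_has_pd)

lemma pd_sum:
  "(\<And>i. i \<in> A \<Longrightarrow> trigpoly (f i)) \<Longrightarrow> pd a (\<lambda>x. \<Sum>i\<in>A. f i x) x = (\<Sum>i\<in>A. pd a (f i) x)"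
  by (rule pd_eqI) (intro has_vector_derivative_sum trigpoly_has_pd)

lemma pd_cnj:
  assumes "trigpoly f"
  shows "pd a (\<lambda>x. cnj (f x)) x = cnj (pd a f x)"
  by (rule pd_eqI) (rule has_vector_derivative_cnj[OF trigpoly_has_pd[OF assms]])

lemma pd_prod:
  assumes "finite A" "\<And>i. i \<in> A \<Longrightarrow> trigpoly (f i)"
  shows "pd a (\<lambda>x. \<Prod>i\<in>A. f i x) x = (\<Sum>i\<in>A. pd a (f i) x * (\<Prod>l\<in>A - {i}. f l x))"
  using assms
proof (induction A rule: finite_induct)
  case (insert k A)
  have "(\<Prod>l\<in>insert k A - {i}. f l x) = f k x * (\<Prod>l\<in>A - {i}. f l x)" if "i \<in> A" for i
  proof -
    have "insert k A - {i} = insert k (A - {i})"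
      using that insert by auto
    with insert show ?thesis
      by simp
  qed
  then have "(\<Sum>i\<in>A. pd a (f i) x * (\<Prod>l\<in>insert k A - {i}. f l x)) =
      f k x * (\<Sum>i\<in>A. pd a (f i) x * (\<Prod>l\<in>A - {i}. f l x))"
    by (simp add: sum_distrib_left mult_ac)
  moreover have "insert k A - {k} = A"
    using insert by auto
  ultimately show ?case
    using insert by (simp add: pd_mult trigpoly_prod)
qed simp

lemma pd_power:
  assumes "trigpoly f"
  shows "pd a (\<lambda>x. f x ^ m) x = of_nat m * f x ^ (m - 1) * pd a f x"
proof (induction m)
  case (Suc m)
  have "pd a (\<lambda>x. f x ^ Suc m) x = f x * pd a (\<lambda>x. f x ^ m) x + pd a f x * f x ^ m"
    using pd_mult[OF assms trigpoly_power[OF assms]] by simp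
  then show ?case
    using Suc by (cases m) (simp_all add: algebra_simps)
qed simp

text \<open>Schwarz's theorem by induction on the structure of \<open>f\<close>: in the product case
  both orders of differentiation expand to the same four terms.\<close>

lemma pd_commute:
  assumes "trigpoly f"
  shows "pd a (pd b f) x = pd b (pd a f) x"
  using assms
proof (induction arbitrary: x rule: trigpoly.induct)
  case (const c)
  have "pd b (\<lambda>x. c) = (\<lambda>x. 0)" for b :: "'a \<times> bool"
    by (rule ext) simp
  then show ?case
    by simp
next
  case (radius j)
  have "pd b (\<lambda>x. of_real (x (j, False))) = (\<lambda>x. if b = (j, False) then 1 else 0)" for b
    by (rule ext) (rule pd_radius)
  then show ?case
    by simp
next
  case (angle k j)
  show ?case
  proof (cases "a = b")
    case False
    have "pd b (\<lambda>x. cis (of_int k * x (j, True))) = (\<lambda>x. 0)" if "b \<noteq> (j, True)" for b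
      using that by (intro ext) (simp add: pd_cis)
    then have *: "pd a (pd b (\<lambda>x. cis (of_int k * x (j, True)))) x = 0" if "b \<noteq> (j, True)" for a b
      using that by simp
    have **: "pd b (pd (j, True) (\<lambda>x. cis (of_int k * x (j, True)))) x = 0" if "b \<noteq> (j, True)" for b
    proof (rule pd_eqI)
      \<comment> \<open>The inner derivative reads its point only at the coordinate
        \<open>(j, True)\<close>, so changing another coordinate \<open>b\<close> leaves it
        alone.\<close>
      have "pd (j, True) (\<lambda>x. cis (of_int k * x (j, True))) (x(b := s)) =
        pd (j, True) (\<lambda>x. cis (of_int k * x (j, True))) x" for s
        using that unfolding pd_def by simp
      then show "((\<lambda>s. pd (j, True) (\<lambda>x. cis (of_int k * x (j, True))) (x(b := s)))
          has_vector_derivative 0) (at (x b))"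
        by simp
    qed
    show ?thesis
      using False * ** by metis
  qed simp
next
  case (add f g)
  have "pd b (\<lambda>x. f x + g x) = (\<lambda>x. pd b f x + pd b g x)" for b
    by (rule ext) (simp add: pd_add add)
  then show ?case
    using add by (simp add: pd_add trigpoly_pd)
next
  case (mult f g)
  have "pd b (\<lambda>x. f x * g x) = (\<lambda>x. f x * pd b g x + pd b f x * g x)" for b
    by (rule ext) (simp add: pd_mult mult)
  then show ?case
    using mult by (simp add: pd_add pd_mult trigpoly_pd trigpoly.mult)
qed

lemma trigpoly_periodic:
  "trigpoly f \<Longrightarrow> f (x((j, True) := 2 * pi)) = f (x((j, True) := 0))"
proof (induction rule: trigpoly.induct)
  case (angle k l)
  have "cis (2 * pi * of_int k) = 1"
    by (rule cis_multiple_2pi) simp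
  then show ?case
    by (simp add: mult_ac)
qed simp_all

text \<open>A direction \<open>b\<close> other than \<open>c\<close> is tangent to the face
  \<open>x c = v\<close>, so the derivative sees only values of \<open>f\<close> on that
  face.\<close>

lemma pd_eq_0_of_constant_on_face:
  assumes "\<And>y. y c = v \<Longrightarrow> f y = d" and "b \<noteq> c" and "x c = v"
  shows "pd b f x = 0"
proof (rule pd_eqI)
  have "f (x(b := s)) = d" for s
    using assms by auto
  then show "((\<lambda>s. f (x(b := s))) has_vector_derivative 0) (at (x b))"
    by simp
qed

lemma trigpoly_continuous:
  fixes f :: "('n::finite \<times> bool \<Rightarrow> real) \<Rightarrow> complex"
  shows "trigpoly f \<Longrightarrow> continuous_on UNIV f"
proof (induction rule: trigpoly.induct)
  case (radius j)
  show ?case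
    by (intro continuous_intros continuous_on_product_coordinates)
next
  case (angle k j)
  show ?case
    by (intro continuous_intros continuous_on_product_coordinates)
qed (auto intro: continuous_intros)

subsection \<open>Integration over the cell\<close>

definition cell_len :: "'n \<times> bool \<Rightarrow> real" where
  "cell_len a = (if snd a then 2 * pi else 1)"

definition cell :: "('n \<times> bool \<Rightarrow> real) set" where
  "cell = (\<Pi>\<^sub>E a\<in>UNIV. {0..cell_len a})"

lemma cell_len_pos: "cell_len a > 0"
  by (simp add: cell_len_def)

lemma zero_in_cell: "(\<lambda>a. 0) \<in> cell"
  using cell_len_pos by (auto simp: cell_def less_eq_real_def)

lemma compact_cell: "compact (cell :: ('n::finite \<times> bool \<Rightarrow> real) set)"
proof -
  have "compactin (product_topology (\<lambda>a::'n \<times> bool. euclidean) UNIV) (\<Pi>\<^sub>E a\<in>UNIV. {0..cell_len a})"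
    by (subst compactin_PiE) auto
  then show ?thesis
    by (simp add: euclidean_product_topology cell_def)
qed

lemma trigpoly_bounded:
  fixes f :: "('n::finite \<times> bool \<Rightarrow> real) \<Rightarrow> complex"
  assumes "trigpoly f"
  obtains C where "\<And>x. x \<in> cell \<Longrightarrow> norm (f x) \<le> C"
proof -
  have "compact (f ` cell)"
    using compact_cell trigpoly_continuous[OF assms]
    by (meson compact_continuous_image continuous_on_subset subset_UNIV)
  then show ?thesis
    using that by (meson compact_imp_bounded bounded_iff imageI)
qed

text \<open>Restricting Lebesgue measure on each side makes the product measure finite with
  \<open>cell\<close> as its whole space, so bounded measurable functions are integrable.\<close>

abbreviation side_measure :: "'n \<times> bool \<Rightarrow> real measure" where
  "side_measure a \<equiv> restrict_space lborel {0..cell_len a}"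

abbreviation cell_measure :: "('n \<times> bool \<Rightarrow> real) measure" where
  "cell_measure \<equiv> PiM UNIV side_measure"

interpretation side: finite_measure "side_measure a" for a
  using cell_len_pos[of a]
  by (intro finite_measureI) (simp add: emeasure_restrict_space space_restrict_space)

interpretation cell: product_sigma_finite side_measure
  by standard

lemma space_cell_measure: "space cell_measure = cell"
  by (simp add: space_PiM cell_def space_restrict_space)

lemma emeasure_cell:
  "emeasure cell_measure (cell :: ('n::finite \<times> bool \<Rightarrow> real) set) = ennreal (\<Prod>a::'n \<times> bool\<in>UNIV. cell_len a)"
proof -
  have "emeasure (side_measure a) {0..cell_len a} = ennreal (cell_len a)" for a :: "'n \<times> bool"
    using cell_len_pos[of a] by (simp add: emeasure_restrict_space)
  moreover have "{0..cell_len a} \<in> sets (side_measure a)" for a :: "'n \<times> bool"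
    by (simp add: sets_restrict_space_iff)
  ultimately show ?thesis
    unfolding cell_def using cell_len_pos
    by (subst cell.emeasure_PiM) (auto intro!: prod_ennreal less_imp_le)
qed

interpretation cell_measure: finite_measure "cell_measure :: ('n::finite \<times> bool \<Rightarrow> real) measure"
  by (rule finite_measureI) (simp add: space_cell_measure emeasure_cell)

lemma measure_cell_pos: "measure cell_measure (cell :: ('n::finite \<times> bool \<Rightarrow> real) set) > 0"
  unfolding measure_def emeasure_cell
  by (subst enn2real_ennreal) (intro prod_nonneg prod_pos less_imp_le cell_len_pos ballI)+

lemma trigpoly_measurable:
  fixes f :: "('n::finite \<times> bool \<Rightarrow> real) \<Rightarrow> complex"
  shows "trigpoly f \<Longrightarrow> f \<in> borel_measurable cell_measure"
proof (induction rule: trigpoly.induct)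
  have *: "(\<lambda>x. x a) \<in> borel_measurable cell_measure" for a :: "'n \<times> bool"
  proof -
    have "(\<lambda>x. x a) \<in> measurable cell_measure (side_measure a)"
      by (rule measurable_component_singleton) simp
    moreover have "(\<lambda>t. t) \<in> borel_measurable (side_measure a)"
      by (rule measurable_restrict_space1) simp
    ultimately show ?thesis
      by (rule measurable_compose)
  qed
  {
    case (radius j)
    show ?case
      using * by measurable
  next
    case (angle k j)
    have "(\<lambda>x. of_int k * x (j, True)) \<in> borel_measurable cell_measure"
      using *[of "(j, True)"] by measurable
    moreover have "cis \<in> borel_measurable borel"
      by (intro borel_measurable_continuous_onI continuous_intros)
    ultimately show ?case
      by (rule measurable_compose)
  }
qed (auto intro: measurable_const)

lemma trigpoly_integrable:
  fixes f :: "('n::finite \<times> bool \<Rightarrow> real) \<Rightarrow> complex"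
  assumes "trigpoly f"
  shows "integrable cell_measure f"
proof -
  obtain C where "\<And>x. x \<in> cell \<Longrightarrow> norm (f x) \<le> C"
    using trigpoly_bounded[OF assms] by blast
  then show ?thesis
    by (intro cell_measure.integrable_const_bound[of _ C] trigpoly_measurable assms AE_I2)
      (simp add: space_cell_measure)
qed

text \<open>Fubini isolates the coordinate \<open>a\<close>; the fundamental theorem of calculus
  turns the inner integral into the difference of the values of \<open>f\<close> at the two ends,
  which agree.\<close>

lemma integral_pd:
  fixes f :: "('n::finite \<times> bool \<Rightarrow> real) \<Rightarrow> complex"
  assumes "trigpoly f"
    and "\<And>x. f (x(a := cell_len a)) = f (x(a := 0))"
  shows "(\<integral>x. pd a f x \<partial>cell_measure) = 0"
proof -
  have "(\<integral>y. pd a f (x(a := y)) \<partial>side_measure a) = 0" for x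
  proof -
    have "continuous_on {0..cell_len a} (\<lambda>y. pd a f (x(a := y)))"
      using has_vector_derivative_continuous[OF trigpoly_has_pd_at[OF trigpoly_pd[OF assms(1)]]]
      by (intro continuous_at_imp_continuous_on) simp
    then have "(\<integral>y. indicator {0..cell_len a} y *\<^sub>R pd a f (x(a := y)) \<partial>lborel) =
        f (x(a := cell_len a)) - f (x(a := 0))"
      using cell_len_pos[of a]
      by (intro integral_FTC_atLeastAtMost has_vector_derivative_at_within[OF trigpoly_has_pd_at[OF assms(1)]])
        simp_all
    then show ?thesis
      using assms(2) by (simp add: integral_restrict_space)
  qed
  moreover have "(\<integral>x. pd a f x \<partial>PiM (insert a (UNIV - {a})) side_measure) =
      (\<integral>x. (\<integral>y. pd a f (x(a := y)) \<partial>side_measure a) \<partial>PiM (UNIV - {a}) side_measure)"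
    by (rule cell.product_integral_insert) (auto simp: insert_UNIV intro!: trigpoly_integrable trigpoly_pd assms)
  ultimately show ?thesis
    by (simp add: insert_UNIV)
qed

section \<open>Alternating sums and Stokes' theorem on the cell\<close>

lemma alternating_sum_transpose:
  fixes h :: "('k::finite \<Rightarrow> 'k) \<Rightarrow> complex"
  assumes "u \<noteq> v"
  shows "(\<Sum>p | p permutes UNIV. of_int (sign p) * h p) =
    - (\<Sum>p | p permutes UNIV. of_int (sign p) * h (p \<circ> Transposition.transpose u v))"
proof -
  have "(\<Sum>p | p permutes UNIV. of_int (sign p) * h p) =
      (\<Sum>p | p permutes UNIV. of_int (sign (p \<circ> Transposition.transpose u v)) *
        h (p \<circ> Transposition.transpose u v))"
    by (rule sum_permutations_compose_right) (simp add: permutes_swap_id)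
  also have "\<dots> = (\<Sum>p | p permutes UNIV. - (of_int (sign p) * h (p \<circ> Transposition.transpose u v)))"
  proof (rule sum.cong[OF refl])
    fix p :: "'k \<Rightarrow> 'k"
    assume "p \<in> {p. p permutes UNIV}"
    then have "permutation p"
      by (auto intro: permutes_imp_permutation)
    then show "of_int (sign (p \<circ> Transposition.transpose u v)) * h (p \<circ> Transposition.transpose u v) =
        - (of_int (sign p) * h (p \<circ> Transposition.transpose u v))"
      using assms by (simp add: sign_compose permutation_swap_id sign_swap_id)
  qed
  finally show ?thesis
    by (simp add: sum_negf)
qed

lemma alternating_sum_eq_0:
  fixes h :: "('k::finite \<Rightarrow> 'k) \<Rightarrow> complex"
  assumes "u \<noteq> v" and "\<And>p. h (p \<circ> Transposition.transpose u v) = h p"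
  shows "(\<Sum>p | p permutes UNIV. of_int (sign p) * h p) = 0"
  using alternating_sum_transpose[OF assms(1), of h] by (simp add: assms(2))

text \<open>The integrand is the top form \<open>d\<delta> \<and> \<And>\<^bsub>k \<noteq> i\<^esub> d\<gamma>\<^sub>k\<close>, with the wedge product written as an
  alternating sum over the permutations of the \<open>2n\<close> coordinates. The face conditions say that, where
  a radius is 0 or 1, no component along the corresponding angle survives.\<close>

lemma stokes_cell:
  fixes \<delta> :: "'n::finite \<times> bool \<Rightarrow> ('n \<times> bool \<Rightarrow> real) \<Rightarrow> complex"
    and \<gamma> :: "'n \<Rightarrow> 'n \<times> bool \<Rightarrow> ('n \<times> bool \<Rightarrow> real) \<Rightarrow> complex"
  assumes \<delta>: "\<And>b. trigpoly (\<delta> b)" and \<gamma>: "\<And>k b. trigpoly (\<gamma> k b)"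
    and face_\<delta>: "\<And>j x. x (j, False) \<in> {0, 1} \<Longrightarrow> \<delta> (j, True) x = 0"
    and face_pd: "\<And>k j b x. x (j, False) \<in> {0, 1} \<Longrightarrow> b \<noteq> (j, False) \<Longrightarrow> pd b (\<gamma> k (j, True)) x = 0"
    and face_pd_angle: "\<And>k j b x. x (j, False) \<in> {0, 1} \<Longrightarrow> b \<noteq> (j, False) \<Longrightarrow> pd (j, True) (\<gamma> k b) x = 0"
  shows "(\<integral>x. (\<Sum>p | p permutes UNIV. of_int (sign p) * (pd (p (i, False)) (\<delta> (p (i, True))) x *
    (\<Prod>k\<in>UNIV - {i}. pd (p (k, False)) (\<gamma> k (p (k, True))) x))) \<partial>cell_measure) = 0"
proof -
  define Q where "Q p x = (\<Prod>k\<in>UNIV - {i}. pd (p (k, False)) (\<gamma> k (p (k, True))) x)"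
    for p :: "'n \<times> bool \<Rightarrow> 'n \<times> bool" and x
  have Q: "trigpoly (Q p)" for p
    unfolding Q_def by (intro trigpoly_intros \<gamma>)
  \<comment> \<open>This is \<open>d (d \<gamma>\<^sub>k) = 0\<close>: where the outer derivative
    hits the factor \<open>k\<close>, swapping the slots \<open>(i, False)\<close> and
    \<open>(k, False)\<close> exchanges two commuting partial derivatives but flips the sign of the
    permutation.\<close>
  have cancel: "(\<Sum>p | p permutes UNIV. of_int (sign p) *
      (\<delta> (p (i, True)) x * pd (p (i, False)) (Q p) x)) = 0" for x
  proof -
    have "pd (p (i, False)) (Q p) x = (\<Sum>k\<in>UNIV - {i}.
        pd (p (i, False)) (pd (p (k, False)) (\<gamma> k (p (k, True)))) x *
        (\<Prod>l\<in>UNIV - {i} - {k}. pd (p (l, False)) (\<gamma> l (p (l, True))) x))" for p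
      unfolding Q_def by (intro pd_prod trigpoly_intros \<gamma>) simp
    then have "(\<Sum>p | p permutes UNIV. of_int (sign p) *
        (\<delta> (p (i, True)) x * pd (p (i, False)) (Q p) x)) =
      (\<Sum>p | p permutes UNIV. \<Sum>k\<in>UNIV - {i}. of_int (sign p) * (\<delta> (p (i, True)) x *
        (pd (p (i, False)) (pd (p (k, False)) (\<gamma> k (p (k, True)))) x *
        (\<Prod>l\<in>UNIV - {i} - {k}. pd (p (l, False)) (\<gamma> l (p (l, True))) x))))"
      by (simp add: sum_distrib_left)
    also have "\<dots> = (\<Sum>k\<in>UNIV - {i}. \<Sum>p | p permutes UNIV. of_int (sign p) * (\<delta> (p (i, True)) x *
        (pd (p (i, False)) (pd (p (k, False)) (\<gamma> k (p (k, True)))) x *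
        (\<Prod>l\<in>UNIV - {i} - {k}. pd (p (l, False)) (\<gamma> l (p (l, True))) x))))"
      by (rule sum.swap)
    also have "\<dots> = 0"
    proof (rule sum.neutral, rule ballI)
      fix k assume k: "k \<in> UNIV - {i}"
      show "(\<Sum>p | p permutes UNIV. of_int (sign p) * (\<delta> (p (i, True)) x *
        (pd (p (i, False)) (pd (p (k, False)) (\<gamma> k (p (k, True)))) x *
        (\<Prod>l\<in>UNIV - {i} - {k}. pd (p (l, False)) (\<gamma> l (p (l, True))) x)))) = 0"
      proof (rule alternating_sum_eq_0[where u = "(i, False)" and v = "(k, False)" and
            h = "\<lambda>p. \<delta> (p (i, True)) x * (pd (p (i, False)) (pd (p (k, False)) (\<gamma> k (p (k, True)))) x *
              (\<Prod>l\<in>UNIV - {i} - {k}. pd (p (l, False)) (\<gamma> l (p (l, True))) x))"])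
        fix p :: "'n \<times> bool \<Rightarrow> 'n \<times> bool"
        let ?p = "p \<circ> Transposition.transpose (i, False) (k, False)"
        have "?p (l, True) = p (l, True)" for l
          by (simp add: Transposition.transpose_def)
        moreover have "?p (i, False) = p (k, False)" "?p (k, False) = p (i, False)"
          by simp_all
        moreover have "?p (l, False) = p (l, False)" if "l \<in> UNIV - {i} - {k}" for l
          using that by (simp add: Transposition.transpose_def)
        moreover have "pd (p (k, False)) (pd (p (i, False)) (\<gamma> k (p (k, True)))) x =
            pd (p (i, False)) (pd (p (k, False)) (\<gamma> k (p (k, True)))) x"
          by (rule pd_commute[OF \<gamma>])
        ultimately show "\<delta> (?p (i, True)) x *
            (pd (?p (i, False)) (pd (?p (k, False)) (\<gamma> k (?p (k, True)))) x *
            (\<Prod>l\<in>UNIV - {i} - {k}. pd (?p (l, False)) (\<gamma> l (?p (l, True))) x)) =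
          \<delta> (p (i, True)) x *
            (pd (p (i, False)) (pd (p (k, False)) (\<gamma> k (p (k, True)))) x *
            (\<Prod>l\<in>UNIV - {i} - {k}. pd (p (l, False)) (\<gamma> l (p (l, True))) x))"
          by (simp del: o_apply)
      next
        show "(i, False) \<noteq> (k, False)"
          using k by auto
      qed
    qed
    finally show ?thesis .
  qed
  \<comment> \<open>By the Leibniz rule and \<open>cancel\<close> the integrand is a sum of total
    partial derivatives, to which \<open>integral_pd\<close> applies.\<close>
  have exact: "(\<Sum>p | p permutes UNIV. of_int (sign p) * (pd (p (i, False)) (\<delta> (p (i, True))) x * Q p x)) =
      (\<Sum>p | p permutes UNIV. of_int (sign p) * pd (p (i, False)) (\<lambda>x. \<delta> (p (i, True)) x * Q p x) x)" for x
    using cancel[of x] by (simp add: pd_mult \<delta> Q algebra_simps sum.distrib)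
  \<comment> \<open>If the direction \<open>p (i, False)\<close> is an angle, the two ends agree by
    periodicity. If it is a radius, the differentiated product vanishes at both ends.\<close>
  have boundary: "(\<integral>x. pd (p (i, False)) (\<lambda>x. \<delta> (p (i, True)) x * Q p x) x \<partial>cell_measure) = 0"
    if p: "p permutes UNIV" for p
  proof (rule integral_pd)
    show "trigpoly (\<lambda>x. \<delta> (p (i, True)) x * Q p x)"
      by (intro trigpoly_intros \<delta> Q)
    then have angle: "\<delta> (p (i, True)) (x((j, True) := 2 * pi)) * Q p (x((j, True) := 2 * pi)) =
        \<delta> (p (i, True)) (x((j, True) := 0)) * Q p (x((j, True) := 0))" for j x
      by (rule trigpoly_periodic)
    have face: "\<delta> (p (i, True)) y * Q p y = 0" if j: "p (i, False) = (j, False)" and y: "y (j, False) \<in> {0, 1}" for j y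
    proof -
      \<comment> \<open>As \<open>p\<close> is onto, the angle \<open>(j, True)\<close> matching the
        radius sits in some slot. In slot \<open>i\<close> it must be the component of \<delta>;
        otherwise it is an index of the factor \<open>k\<close> of \<open>Q p\<close>.\<close>
      obtain k t where kt: "p (k, t) = (j, True)"
        using permutes_surj[OF p] by (metis surj_def surj_pair)
      show ?thesis
      proof (cases "k = i")
        case True
        with kt j have "p (i, True) = (j, True)"
          by (cases t) auto
        then show ?thesis
          using face_\<delta>[of y j, OF y] by simp
      next
        case False
        \<comment> \<open>Slot \<open>(i, False)\<close> already holds the radius
          \<open>(j, False)\<close>, so the other index of the factor \<open>k\<close> is tangent to
          the face.\<close>
        have ne: "p (k, s) \<noteq> (j, False)" for s
          using False j permutes_inj[OF p] by (metis injD prod.inject)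
        have "pd (p (k, False)) (\<gamma> k (p (k, True))) y = 0"
          using kt face_pd[of y j, OF y ne] face_pd_angle[of y j, OF y ne] by (cases t) auto
        with False have "Q p y = 0"
          unfolding Q_def by (intro prod_zero) auto
        then show ?thesis
          by simp
      qed
    qed
    obtain j t where "p (i, False) = (j, t)"
      by (cases "p (i, False)")
    then show "\<delta> (p (i, True)) (x(p (i, False) := cell_len (p (i, False)))) * Q p (x(p (i, False) := cell_len (p (i, False)))) =
        \<delta> (p (i, True)) (x(p (i, False) := 0)) * Q p (x(p (i, False) := 0))" for x
      using angle face[of j "x((j, False) := 1)"] face[of j "x((j, False) := 0)"]
      by (cases t) (auto simp: cell_len_def)
  qed
  have "(\<integral>x. (\<Sum>p | p permutes UNIV. of_int (sign p) *
      pd (p (i, False)) (\<lambda>x. \<delta> (p (i, True)) x * Q p x) x) \<partial>cell_measure) =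
    (\<Sum>p | p permutes UNIV. \<integral>x. of_int (sign p) *
      pd (p (i, False)) (\<lambda>x. \<delta> (p (i, True)) x * Q p x) x \<partial>cell_measure)"
    by (intro Bochner_Integration.integral_sum trigpoly_integrable trigpoly_intros \<delta> Q)
  also have "\<dots> = 0"
    using boundary by (intro sum.neutral) simp
  finally show ?thesis
    unfolding exact[symmetric] by (simp add: Q_def)
qed

subsection \<open>Thom forms of sections of line bundles\<close>

text \<open>The face condition says that \<open>f i\<close> descends to a section of the line bundle with degrees
  \<open>\<sigma> i j\<close> on a product of spheres: it does not depend on an angle where the radius is 0, and it
  rotates with weight \<open>\<sigma> i j\<close> where the radius is 1.\<close>

locale line_sections =
  fixes f :: "'n::finite \<Rightarrow> ('n \<times> bool \<Rightarrow> real) \<Rightarrow> complex"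
    and \<sigma> :: "'n \<Rightarrow> 'n \<Rightarrow> int"
  assumes trigpoly_f: "\<And>i. trigpoly (f i)"
    and face_f: "\<And>i j x. x (j, False) \<in> {0, 1} \<Longrightarrow>
      pd (j, True) (f i) x = \<i> * of_int (\<sigma> i j) * of_real (x (j, False)) * f i x"
begin

text \<open>\<open>\<alpha>\<close> is a connection form and \<open>\<omega> = Im (cnj f \<cdot> df)\<close>. Since \<open>P + \<rho> H = 1\<close>, the form
  \<open>\<gamma> = P \<alpha> + H \<omega>\<close> interpolates between \<open>\<alpha>\<close> where \<open>f\<close> vanishes and the closed form
  \<open>\<omega> / \<rho> = d (arg f)\<close> where \<open>P\<close> is negligible.\<close>

definition \<rho> :: "'n \<Rightarrow> ('n \<times> bool \<Rightarrow> real) \<Rightarrow> complex" where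
  "\<rho> i x = f i x * cnj (f i x)"

definition \<alpha> :: "'n \<Rightarrow> 'n \<times> bool \<Rightarrow> ('n \<times> bool \<Rightarrow> real) \<Rightarrow> complex" where
  "\<alpha> i b x = (if snd b then of_int (\<sigma> i (fst b)) else 0) * of_real (x (fst b, False))"

definition \<omega> :: "'n \<Rightarrow> 'n \<times> bool \<Rightarrow> ('n \<times> bool \<Rightarrow> real) \<Rightarrow> complex" where
  "\<omega> i b x = (- \<i> / 2) * (cnj (f i x) * pd b (f i) x - f i x * cnj (pd b (f i) x))"

definition P :: "nat \<Rightarrow> 'n \<Rightarrow> ('n \<times> bool \<Rightarrow> real) \<Rightarrow> complex" where
  "P m i x = (1 - \<rho> i x) ^ m"

definition H :: "nat \<Rightarrow> 'n \<Rightarrow> ('n \<times> bool \<Rightarrow> real) \<Rightarrow> complex" where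
  "H m i x = (\<Sum>k<m. (1 - \<rho> i x) ^ k)"

definition \<gamma> :: "nat \<Rightarrow> 'n \<Rightarrow> 'n \<times> bool \<Rightarrow> ('n \<times> bool \<Rightarrow> real) \<Rightarrow> complex" where
  "\<gamma> m i b x = P m i x * \<alpha> i b x + H m i x * \<omega> i b x"

lemma trigpolys: "trigpoly (\<rho> i)" "trigpoly (\<alpha> i b)" "trigpoly (\<omega> i b)"
  "trigpoly (P m i)" "trigpoly (H m i)" "trigpoly (\<gamma> m i b)"
proof -
  show *: "trigpoly (\<rho> i)" "trigpoly (\<alpha> i b)" "trigpoly (\<omega> i b)"
    unfolding \<rho>_def \<alpha>_def \<omega>_def by (intro trigpoly_intros trigpoly_f)+
  show **: "trigpoly (P m i)" "trigpoly (H m i)"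
    unfolding P_def H_def by (intro trigpoly_intros *)+
  show "trigpoly (\<gamma> m i b)"
    unfolding \<gamma>_def by (intro trigpoly_intros * **)
qed

lemma P_plus_\<rho>_H: "P m i x + \<rho> i x * H m i x = 1"
  using one_diff_power_eq[of "1 - \<rho> i x" m] by (simp add: P_def H_def diff_eq_eq add.commute)

lemma pd_\<rho>: "pd a (\<rho> i) x = f i x * cnj (pd a (f i) x) + pd a (f i) x * cnj (f i x)"
  unfolding \<rho>_def by (simp add: pd_mult pd_cnj trigpoly_cnj trigpoly_f)

lemma pd_one_minus_\<rho>: "pd a (\<lambda>x. 1 - \<rho> i x) x = - pd a (\<rho> i) x"
  by (simp add: pd_diff trigpolys trigpoly.const)

lemma trigpoly_one_minus_\<rho>: "trigpoly (\<lambda>x. 1 - \<rho> i x)"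
  by (intro trigpoly_intros trigpolys)

lemma pd_P: "pd a (P m i) x = - (of_nat m * (1 - \<rho> i x) ^ (m - 1)) * pd a (\<rho> i) x"
  unfolding P_def by (simp add: pd_power trigpoly_one_minus_\<rho> pd_one_minus_\<rho>)

lemma pd_H: "pd a (H m i) x = - (\<Sum>k<m. of_nat k * (1 - \<rho> i x) ^ (k - 1)) * pd a (\<rho> i) x"
  unfolding H_def
  by (simp add: pd_sum pd_power trigpoly_power trigpoly_one_minus_\<rho> pd_one_minus_\<rho> sum_negf sum_distrib_right)

lemma pd_\<alpha>: "pd a (\<alpha> i b) x = (if snd b \<and> a = (fst b, False) then of_int (\<sigma> i (fst b)) else 0)"
  unfolding \<alpha>_def by (simp add: pd_cmult pd_radius trigpoly.radius)

lemma pd_\<omega>: "pd a (\<omega> i b) x = (- \<i> / 2) *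
    (cnj (pd a (f i) x) * pd b (f i) x + cnj (f i x) * pd a (pd b (f i)) x
      - pd a (f i) x * cnj (pd b (f i) x) - f i x * cnj (pd a (pd b (f i)) x))"
proof -
  have "pd a (\<omega> i b) x = (- \<i> / 2) *
      pd a (\<lambda>x. cnj (f i x) * pd b (f i) x - f i x * cnj (pd b (f i) x)) x"
    unfolding \<omega>_def by (intro pd_cmult trigpoly_intros trigpoly_f)
  also have "pd a (\<lambda>x. cnj (f i x) * pd b (f i) x - f i x * cnj (pd b (f i) x)) x =
      pd a (\<lambda>x. cnj (f i x) * pd b (f i) x) x - pd a (\<lambda>x. f i x * cnj (pd b (f i) x)) x"
    by (intro pd_diff trigpoly_intros trigpoly_f)
  finally show ?thesis
    by (simp add: pd_mult pd_cnj trigpoly_f trigpoly_cnj trigpoly_pd algebra_simps)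
qed

lemma pd_\<gamma>: "pd a (\<gamma> m i b) x = P m i x * pd a (\<alpha> i b) x + pd a (P m i) x * \<alpha> i b x
    + H m i x * pd a (\<omega> i b) x + pd a (H m i) x * \<omega> i b x"
  unfolding \<gamma>_def by (simp add: pd_add pd_mult trigpolys trigpoly.mult)

lemma \<gamma>_0: "\<gamma> 0 i b = \<alpha> i b"
  by (rule ext) (simp add: \<gamma>_def P_def H_def)

text \<open>On the face, \<omega> along the angle is \<rho> times the corresponding component of
  \<alpha>, so the identity \<open>P + \<rho> H = 1\<close> removes all dependence on
  \<open>m\<close>. This makes the boundary terms agree for different \<open>m\<close>.\<close>

lemma face_\<gamma>:
  assumes "x (j, False) \<in> {0, 1}"
  shows "\<gamma> m i (j, True) x = of_int (\<sigma> i j) * of_real (x (j, False))"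
proof -
  let ?c = "of_int (\<sigma> i j) * complex_of_real (x (j, False))"
  have "\<omega> i (j, True) x = ?c * \<rho> i x"
    using face_f[of x j i, OF assms] by (simp add: \<omega>_def \<rho>_def algebra_simps)
  then have "\<gamma> m i (j, True) x = ?c * (P m i x + \<rho> i x * H m i x)"
    by (simp add: \<gamma>_def \<alpha>_def algebra_simps)
  then show ?thesis
    by (simp add: P_plus_\<rho>_H)
qed

lemma face_pd_\<gamma>:
  assumes "x (j, False) \<in> {0, 1}" and "b \<noteq> (j, False)"
  shows "pd b (\<gamma> m i (j, True)) x = 0"
proof (rule pd_eq_0_of_constant_on_face[OF _ assms(2) refl])
  show "\<gamma> m i (j, True) y = of_int (\<sigma> i j) * of_real (x (j, False))" if "y (j, False) = x (j, False)" for y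
    using face_\<gamma>[of y j m i] assms(1) that by simp
qed

text \<open>On the face \<open>f i\<close> rotates at the purely imaginary rate \<open>?c\<close>,
  and its tangential derivatives rotate at the same rate. Hence \<rho> and the tangential components
  of \<omega> are invariant under the rotation.\<close>

lemma face_pd_angle_\<gamma>:
  assumes x: "x (j, False) \<in> {0, 1}" and b: "b \<noteq> (j, False)"
  shows "pd (j, True) (\<gamma> m i b) x = 0"
proof -
  let ?c = "\<i> * of_int (\<sigma> i j) * complex_of_real (x (j, False))"
  have c: "cnj ?c = - ?c"
    by simp
  have f: "pd (j, True) (f i) x = ?c * f i x"
    by (rule face_f[of x j i, OF x])
  \<comment> \<open>The rotation equation holds on the whole face and may therefore be
    differentiated in the tangential direction \<open>b\<close>.\<close>
  have "pd b (\<lambda>y. pd (j, True) (f i) y - ?c * f i y) x = 0"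
    by (rule pd_eq_0_of_constant_on_face[where d = 0, OF _ b refl]) (use x face_f in auto)
  then have "pd b (pd (j, True) (f i)) x = ?c * pd b (f i) x"
    by (simp add: pd_diff pd_cmult trigpoly_f trigpoly_pd trigpoly.mult trigpoly.const)
  then have ff: "pd (j, True) (pd b (f i)) x = ?c * pd b (f i) x"
    by (simp add: pd_commute trigpoly_f)
  have "pd (j, True) (\<rho> i) x = 0"
    by (simp add: pd_\<rho> f)
  then have "pd (j, True) (P m i) x = 0" "pd (j, True) (H m i) x = 0"
    by (simp_all add: pd_P pd_H)
  moreover have "pd (j, True) (\<alpha> i b) x = 0"
    by (simp add: pd_\<alpha>)
  moreover have "pd (j, True) (\<omega> i b) x = 0"
    by (simp add: pd_\<omega> f ff)
  ultimately show ?thesis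
    by (simp add: pd_\<gamma>)
qed

text \<open>The coefficient of the volume form in
  \<open>d\<gamma>\<^sub>1 \<and> \<dots> \<and> d\<gamma>\<^sub>n\<close>: slot
  \<open>(k, False)\<close> of the permutation gives the direction of differentiation and slot
  \<open>(k, True)\<close> the component of the k-th form. Each form has its own exponent
  \<open>m k\<close>, so that the exponents can be changed one at a time.\<close>

definition density :: "('n \<Rightarrow> nat) \<Rightarrow> ('n \<times> bool \<Rightarrow> real) \<Rightarrow> complex" where
  "density m x = (\<Sum>p | p permutes UNIV. of_int (sign p) *
    (\<Prod>k\<in>UNIV. pd (p (k, False)) (\<gamma> (m k) k (p (k, True))) x))"

lemma trigpoly_density: "trigpoly (density m)"
  unfolding density_def by (intro trigpoly_intros trigpolys)

text \<open>The density is linear in the i-th form. The difference of its two versions has no angle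
  component on the faces, by \<open>face_\<gamma>\<close>, and so serves as \<delta> in
  \<open>stokes_cell\<close>.\<close>

lemma integral_density_upd: "(\<integral>x. density m x \<partial>cell_measure) = (\<integral>x. density (m(i := 0)) x \<partial>cell_measure)"
proof -
  let ?\<delta> = "\<lambda>b x. \<gamma> (m i) i b x - \<gamma> 0 i b x"
  have "density m x - density (m(i := 0)) x =
      (\<Sum>p | p permutes UNIV. of_int (sign p) * (pd (p (i, False)) (?\<delta> (p (i, True))) x *
        (\<Prod>k\<in>UNIV - {i}. pd (p (k, False)) (\<gamma> (m k) k (p (k, True))) x)))" for x
  proof -
    have split: "(\<Prod>k\<in>UNIV. pd (p (k, False)) (\<gamma> (m' k) k (p (k, True))) x) =
        pd (p (i, False)) (\<gamma> (m' i) i (p (i, True))) x *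
        (\<Prod>k\<in>UNIV - {i}. pd (p (k, False)) (\<gamma> (m' k) k (p (k, True))) x)" for m' p
      by (simp add: prod.remove)
    have "(\<Prod>k\<in>UNIV. pd (p (k, False)) (\<gamma> ((m(i := 0)) k) k (p (k, True))) x) =
        pd (p (i, False)) (\<gamma> 0 i (p (i, True))) x *
        (\<Prod>k\<in>UNIV - {i}. pd (p (k, False)) (\<gamma> (m k) k (p (k, True))) x)" for p
      unfolding split by (intro arg_cong2[where f = "(*)"] prod.cong) auto
    then show ?thesis
      unfolding density_def sum_subtractf[symmetric] using split[of _ m]
      by (simp add: pd_diff trigpolys algebra_simps del: fun_upd_apply)
  qed
  then have "(\<integral>x. density m x - density (m(i := 0)) x \<partial>cell_measure) = 0"
    by simp (intro stokes_cell trigpoly_intros trigpolys; simp add: face_\<gamma> face_pd_\<gamma> face_pd_angle_\<gamma>)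
  moreover have "(\<integral>x. density m x - density (m(i := 0)) x \<partial>cell_measure) =
      (\<integral>x. density m x \<partial>cell_measure) - (\<integral>x. density (m(i := 0)) x \<partial>cell_measure)"
    by (intro Bochner_Integration.integral_diff trigpoly_integrable trigpoly_density)
  ultimately show ?thesis
    by simp
qed

lemma integral_density_eq: "(\<integral>x. density m x \<partial>cell_measure) = (\<integral>x. density (\<lambda>k. 0) x \<partial>cell_measure)"
proof -
  \<comment> \<open>The exponents are reset to 0 one index at a time.\<close>
  have "(\<integral>x. density m x \<partial>cell_measure) = (\<integral>x. density (\<lambda>k. if k \<in> A then 0 else m k) x \<partial>cell_measure)"
    if "finite A" for A
    using that
  proof (induction A rule: finite_induct)
    case (insert i A)
    have "(\<lambda>k. if k \<in> A then 0 else m k)(i := 0) = (\<lambda>k. if k \<in> insert i A then 0 else m k)"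
      by auto
    with insert integral_density_upd[of "\<lambda>k. if k \<in> A then 0 else m k" i] show ?case
      by simp
  qed simp
  from this[of UNIV] show ?thesis
    by simp
qed

end

section \<open>The permanent as an alternating sum over coordinate permutations\<close>

lemma sign_map_prod_id:
  fixes \<tau> :: "'n::finite \<Rightarrow> 'n"
  assumes "\<tau> permutes UNIV"
  shows "permutation (map_prod \<tau> (id :: bool \<Rightarrow> bool)) \<and> sign (map_prod \<tau> (id :: bool \<Rightarrow> bool)) = 1"
  using assms finite
proof (induction rule: permutes_induct)
  case id
  show ?case
    by (simp add: prod.map_id0)
next
  case (swap a b p)
  \<comment> \<open>A transposition of indices lifts to two transpositions of coordinates, one on
    radii and one on angles, so the sign does not change.\<close>
  have "map_prod (Transposition.transpose a b \<circ> p) (id :: bool \<Rightarrow> bool) =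
      Transposition.transpose (a, False) (b, False) \<circ>
      (Transposition.transpose (a, True) (b, True) \<circ> map_prod p id)"
    by (auto simp: fun_eq_iff Transposition.transpose_def)
  moreover have "permutation (map_prod p (id :: bool \<Rightarrow> bool))" "sign (map_prod p (id :: bool \<Rightarrow> bool)) = 1"
    using swap by blast+
  ultimately show ?case
    using \<open>a \<noteq> b\<close> by (simp only: sign_compose permutation_swap_id permutation_compose sign_swap_id) simp
qed

text \<open>This evaluates the density for the forms \<alpha>, whose differentials contain only
  products of a radius with its own angle. The surviving permutations send each such pair to such a
  pair; they are the lifts of index permutations and all have sign 1.\<close>

lemma alternating_sum_diagonal:
  fixes M :: "'n::finite \<Rightarrow> 'n \<Rightarrow> int"
  shows "(\<Sum>p | p permutes (UNIV :: ('n \<times> bool) set). of_int (sign p) *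
      (\<Prod>k\<in>UNIV. if snd (p (k, True)) \<and> p (k, False) = (fst (p (k, True)), False)
        then of_int (M k (fst (p (k, True)))) else 0)) = (of_int (permanent M) :: complex)"
proof -
  define lift where "lift \<tau> = map_prod \<tau> (id :: bool \<Rightarrow> bool)" for \<tau> :: "'n \<Rightarrow> 'n"
  let ?Q = "\<lambda>p k. snd (p (k, True)) \<and> p (k, False) = (fst (p (k, True)), False)"
  let ?g = "\<lambda>p. of_int (sign p) * (\<Prod>k\<in>UNIV. if ?Q p k then of_int (M k (fst (p (k, True)))) else 0) :: complex"
  have img: "lift ` {\<tau>. \<tau> permutes UNIV} = {p. p permutes UNIV \<and> (\<forall>k. ?Q p k)}"
  proof (intro equalityI subsetI)
    fix p :: "'n \<times> bool \<Rightarrow> 'n \<times> bool"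
    assume "p \<in> lift ` {\<tau>. \<tau> permutes UNIV}"
    then obtain \<tau> where \<tau>: "\<tau> permutes UNIV" "p = lift \<tau>"
      by auto
    then have "bij p"
      unfolding lift_def bij_def by (auto intro!: prod.inj_map map_prod_surj dest: permutes_inj permutes_surj)
    then have "p permutes UNIV"
      by (intro bij_imp_permutes) auto
    with \<tau> show "p \<in> {p. p permutes UNIV \<and> (\<forall>k. ?Q p k)}"
      by (simp add: lift_def)
  next
    fix p :: "'n \<times> bool \<Rightarrow> 'n \<times> bool"
    assume p: "p \<in> {p. p permutes UNIV \<and> (\<forall>k. ?Q p k)}"
    define \<tau> where "\<tau> k = fst (p (k, True))" for k
    have pT: "p (k, True) = (\<tau> k, True)" and pF: "p (k, False) = (\<tau> k, False)" for k
      using p by (auto simp: \<tau>_def prod_eq_iff)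
    have "p = lift \<tau>"
    proof
      fix y
      show "p y = lift \<tau> y"
        by (cases y; cases "snd y") (auto simp: lift_def pT pF)
    qed
    moreover have "inj \<tau>"
    proof (rule injI)
      fix k l assume "\<tau> k = \<tau> l"
      then have "p (k, True) = p (l, True)"
        by (simp add: pT)
      with p show "k = l"
        by (auto dest: permutes_inj injD)
    qed
    then have "bij \<tau>"
      by (simp add: bij_def finite_UNIV_inj_surj)
    then have "\<tau> permutes UNIV"
      by (intro bij_imp_permutes) auto
    ultimately show "p \<in> lift ` {\<tau>. \<tau> permutes UNIV}"
      by blast
  qed
  have inj: "inj_on lift {\<tau>. \<tau> permutes UNIV}"
    by (rule inj_onI) (auto simp: lift_def fun_eq_iff)
  have "(\<Sum>p | p permutes UNIV. ?g p) = (\<Sum>p | p permutes UNIV \<and> (\<forall>k. ?Q p k). ?g p)"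
  proof (rule sum.mono_neutral_right)
    show "\<forall>p\<in>{p. p permutes UNIV} - {p. p permutes UNIV \<and> (\<forall>k. ?Q p k)}. ?g p = 0"
    proof
      fix p :: "'n \<times> bool \<Rightarrow> 'n \<times> bool"
      assume "p \<in> {p. p permutes UNIV} - {p. p permutes UNIV \<and> (\<forall>k. ?Q p k)}"
      then obtain k where "\<not> ?Q p k"
        by auto
      then have "(\<Prod>k\<in>UNIV. if ?Q p k then of_int (M k (fst (p (k, True)))) else (0 :: complex)) = 0"
        by (intro prod_zero) auto
      then show "?g p = 0"
        by simp
    qed
  qed (auto simp: finite_permutations)
  also have "\<dots> = (\<Sum>\<tau> | \<tau> permutes UNIV. ?g (lift \<tau>))"
    unfolding img[symmetric] by (simp add: sum.reindex[OF inj])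
  also have "\<dots> = (\<Sum>\<tau> | \<tau> permutes UNIV. of_int (\<Prod>k\<in>UNIV. M k (\<tau> k)))"
    using sign_map_prod_id by (intro sum.cong) (auto simp: lift_def)
  finally show ?thesis
    by (simp add: permanent_def)
qed

section \<open>Uniform bounds and limits for the decay estimate\<close>

lemma trigpoly_family_bounded:
  fixes A :: "(('n::finite \<times> bool \<Rightarrow> real) \<Rightarrow> complex) set"
  assumes "finite A" "\<And>g. g \<in> A \<Longrightarrow> trigpoly g"
  obtains C where "C \<ge> 1" "\<And>g x. g \<in> A \<Longrightarrow> x \<in> cell \<Longrightarrow> norm (g x) \<le> C"
proof -
  have "\<exists>C\<ge>1. \<forall>g\<in>A. \<forall>x\<in>cell. norm (g x) \<le> C"
    using assms
  proof (induction A rule: finite_induct)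
    case (insert g A)
    then obtain C where C: "C \<ge> 1" "\<forall>g\<in>A. \<forall>x\<in>cell. norm (g x) \<le> C"
      by auto
    obtain C' where C': "\<And>x. x \<in> cell \<Longrightarrow> norm (g x) \<le> C'"
      using trigpoly_bounded insert.prems by blast
    show ?case
      using C C' by (intro exI[of _ "max C C'"]) (auto simp: le_max_iff_disj)
  qed auto
  then show ?thesis
    using that by blast
qed

text \<open>Up to sign, the derivative in \<open>z\<close> of
  \<open>(1 - z) * (\<Sum>k<m. z ^ k) = 1 - z ^ m\<close>.\<close>

lemma geometric_sum_derivative:
  fixes z :: complex
  shows "(\<Sum>k<m. z ^ k) - (1 - z) * (\<Sum>k<m. of_nat k * z ^ (k - 1)) = of_nat m * z ^ (m - 1)"
proof (induction m)
  case (Suc m)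
  have "(\<Sum>k<Suc m. z ^ k) - (1 - z) * (\<Sum>k<Suc m. of_nat k * z ^ (k - 1)) =
      ((\<Sum>k<m. z ^ k) - (1 - z) * (\<Sum>k<m. of_nat k * z ^ (k - 1))) +
      (z ^ m - (1 - z) * (of_nat m * z ^ (m - 1)))"
    by (simp add: algebra_simps)
  also have "\<dots> = of_nat (Suc m) * z ^ m"
    unfolding Suc by (cases m) (simp_all add: algebra_simps)
  finally show ?case
    by simp
qed simp

lemma polynomial_times_geometric_tendsto_0:
  fixes q :: real
  assumes "0 \<le> q" "q < 1" "0 < d"
  shows "(\<lambda>m. (real m + 2) ^ d * q ^ m) \<longlonglongrightarrow> 0"
proof -
  \<comment> \<open>With the d-th root \<open>s\<close> of \<open>q\<close> the sequence is the d-th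
    power of \<open>(m + 2) * s ^ m\<close>, which tends to 0.\<close>
  define s where "s = root d q"
  have s: "0 \<le> s" "s < 1" "s ^ d = q"
    using assms by (auto simp: s_def real_root_pow_pos2)
  have "(\<lambda>m. real m * s ^ m + 2 * s ^ m) \<longlonglongrightarrow> 0 + 2 * 0"
    using s powser_times_n_limit_0[of s] by (intro tendsto_intros LIMSEQ_power_zero) auto
  then have "(\<lambda>m. (real m * s ^ m + 2 * s ^ m) ^ d) \<longlonglongrightarrow> 0 ^ d"
    by (intro tendsto_power) simp
  moreover have "(real m * s ^ m + 2 * s ^ m) ^ d = (real m + 2) ^ d * q ^ m" for m
  proof -
    have "(real m * s ^ m + 2 * s ^ m) ^ d = ((real m + 2) * s ^ m) ^ d"
      by (simp add: algebra_simps)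
    also have "\<dots> = (real m + 2) ^ d * (s ^ d) ^ m"
      by (simp add: power_mult_distrib power_mult[symmetric] mult.commute)
    finally show ?thesis
      using s by simp
  qed
  ultimately show ?thesis
    using assms by (simp add: zero_power)
qed

section \<open>Decay of the forms and vanishing of the permanent\<close>

context line_sections
begin

lemma density_0: "density (\<lambda>k. 0) x = of_int (permanent \<sigma>)"
  unfolding density_def \<gamma>_0 pd_\<alpha> by (rule alternating_sum_diagonal)

text \<open>Expanding \<open>d\<gamma>\<close> leaves
  \<open>H d\<omega> + dH \<and> \<omega>\<close>, and
  \<open>d\<rho> \<and> \<omega> = \<rho> d\<omega>\<close> combines the two into
  \<open>m (1 - \<rho>)^(m - 1) d\<omega>\<close>. Every term then carries a high power of
  \<open>1 - \<rho>\<close>, which is the source of the decay.\<close>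

lemma d\<gamma>_eq:
  "pd a (\<gamma> m i b) x - pd b (\<gamma> m i a) x =
    P m i x * (pd a (\<alpha> i b) x - pd b (\<alpha> i a) x)
    - of_nat m * (1 - \<rho> i x) ^ (m - 1) * (pd a (\<rho> i) x * \<alpha> i b x - pd b (\<rho> i) x * \<alpha> i a x)
    + of_nat m * (1 - \<rho> i x) ^ (m - 1) * (pd a (\<omega> i b) x - pd b (\<omega> i a) x)"
proof -
  define h where "h = (\<Sum>k<m. of_nat k * (1 - \<rho> i x) ^ (k - 1))"
  \<comment> \<open>In polar form \<open>f = r e^(i t)\<close> this reads
    \<open>d(r^2) \<and> r^2 dt = r^2 d(r^2 dt)\<close>; the second derivatives of
    \<open>f i\<close> cancel because they commute.\<close>
  have d\<omega>: "pd a (\<rho> i) x * \<omega> i b x - pd b (\<rho> i) x * \<omega> i a x = \<rho> i x * (pd a (\<omega> i b) x - pd b (\<omega> i a) x)"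
    unfolding pd_\<rho> pd_\<omega> pd_commute[OF trigpoly_f, of a b] by (simp add: \<omega>_def \<rho>_def algebra_simps)
  have H: "of_nat m * (1 - \<rho> i x) ^ (m - 1) = H m i x - \<rho> i x * h"
    using geometric_sum_derivative[of "1 - \<rho> i x" m] by (simp add: H_def h_def)
  have "pd a (\<gamma> m i b) x - pd b (\<gamma> m i a) x =
    P m i x * (pd a (\<alpha> i b) x - pd b (\<alpha> i a) x)
    - of_nat m * (1 - \<rho> i x) ^ (m - 1) * (pd a (\<rho> i) x * \<alpha> i b x - pd b (\<rho> i) x * \<alpha> i a x)
    + H m i x * (pd a (\<omega> i b) x - pd b (\<omega> i a) x)
    - h * (pd a (\<rho> i) x * \<omega> i b x - pd b (\<rho> i) x * \<omega> i a x)"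
    unfolding pd_\<gamma> pd_P pd_H h_def[symmetric] by (simp add: algebra_simps)
  then show ?thesis
    unfolding d\<omega> H by (simp add: algebra_simps)
qed

text \<open>The individual derivatives \<open>pd a (\<gamma> m i b)\<close> are not small for large \<open>m\<close>; only their
  antisymmetrization \<open>d\<gamma>\<close> is, and it suffices to antisymmetrize in one slot.\<close>

lemma density_antisymmetrized:
  "2 * density m x = (\<Sum>p | p permutes UNIV. of_int (sign p) *
    ((pd (p (i, False)) (\<gamma> (m i) i (p (i, True))) x - pd (p (i, True)) (\<gamma> (m i) i (p (i, False))) x) *
    (\<Prod>k\<in>UNIV - {i}. pd (p (k, False)) (\<gamma> (m k) k (p (k, True))) x)))"
proof -
  define Q where "Q p = (\<Prod>k\<in>UNIV - {i}. pd (p (k, False)) (\<gamma> (m k) k (p (k, True))) x)"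
    for p :: "'n \<times> bool \<Rightarrow> 'n \<times> bool"
  have 1: "density m x = (\<Sum>p | p permutes UNIV. of_int (sign p) *
      (pd (p (i, False)) (\<gamma> (m i) i (p (i, True))) x * Q p))"
    unfolding density_def Q_def by (simp add: prod.remove[of UNIV i])
  \<comment> \<open>Exchanging the two indices of slot \<open>i\<close> leaves the other factors
    alone and flips the sign, which gives a second expression for the same density.\<close>
  have "Q (p \<circ> Transposition.transpose (i, False) (i, True)) = Q p" for p
    unfolding Q_def by (rule prod.cong) (auto simp: Transposition.transpose_def)
  then have 2: "density m x = - (\<Sum>p | p permutes UNIV. of_int (sign p) *
      (pd (p (i, True)) (\<gamma> (m i) i (p (i, False))) x * Q p))"
    unfolding 1 by (subst alternating_sum_transpose[of "(i, False)" "(i, True)"]) simp_all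
  have "2 * density m x = (\<Sum>p | p permutes UNIV. of_int (sign p) *
      (pd (p (i, False)) (\<gamma> (m i) i (p (i, True))) x * Q p)) - (\<Sum>p | p permutes UNIV. of_int (sign p) *
      (pd (p (i, True)) (\<gamma> (m i) i (p (i, False))) x * Q p))"
    unfolding 1[symmetric] using 2 by simp
  also have "\<dots> = (\<Sum>p | p permutes UNIV. of_int (sign p) *
      ((pd (p (i, False)) (\<gamma> (m i) i (p (i, True))) x - pd (p (i, True)) (\<gamma> (m i) i (p (i, False))) x) * Q p))"
    unfolding sum_subtractf[symmetric] by (simp only: left_diff_distrib right_diff_distrib)
  finally show ?thesis
    by (simp only: Q_def)
qed

text \<open>At each point of the cell some \<open>f i\<close> is bounded away from 0, so one
  antisymmetrized factor of the density decays like \<open>q ^ m\<close> while the others grow at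
  most polynomially in \<open>m\<close>. The integral, constant in \<open>m\<close>, is therefore 0.
  The bound \<open>norm (f i x) \<le> 1\<close> keeps \<open>1 - \<rho>\<close> in [0, 1].\<close>

lemma permanent_eq_0_of_no_common_zero:
  assumes small: "\<And>i x. x \<in> cell \<Longrightarrow> norm (f i x) \<le> 1"
    and nonzero: "\<And>x. x \<in> cell \<Longrightarrow> \<exists>i. f i x \<noteq> 0"
  shows "permanent \<sigma> = 0"
proof -
  have \<rho>: "norm (1 - \<rho> i x) = 1 - (norm (f i x))\<^sup>2" if "x \<in> cell" for i x
  proof -
    have "\<rho> i x = of_real ((norm (f i x))\<^sup>2)"
      unfolding \<rho>_def by (rule complex_norm_square[symmetric])
    then have "1 - \<rho> i x = of_real (1 - (norm (f i x))\<^sup>2)"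
      by simp
    moreover have "(norm (f i x))\<^sup>2 \<le> 1"
      using small[OF that, of i] by (simp add: power_le_one)
    ultimately show ?thesis
      by (simp only: norm_of_real)
  qed
  \<comment> \<open>The sum of all squared norms has a positive minimum on the compact cell, and at
    each point some summand is at least this minimum divided by \<open>n\<close>.\<close>
  obtain c where c: "0 < c" "\<And>x. x \<in> cell \<Longrightarrow> \<exists>i. c \<le> (norm (f i x))\<^sup>2"
  proof -
    let ?g = "\<lambda>x. \<Sum>i\<in>UNIV. (norm (f i x))\<^sup>2"
    have "continuous_on cell (f i)" for i
      using trigpoly_continuous[OF trigpoly_f] continuous_on_subset by blast
    then have cont: "continuous_on cell ?g"
      by (intro continuous_intros)
    obtain x0 where x0: "x0 \<in> cell" "\<And>x. x \<in> cell \<Longrightarrow> ?g x0 \<le> ?g x"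
      using continuous_attains_inf[OF compact_cell _ cont] zero_in_cell by blast
    have pos: "0 < ?g x0"
      using nonzero[OF x0(1)] by (auto intro!: sum_pos2)
    show ?thesis
    proof (rule that)
      show "0 < ?g x0 / CARD('n)"
        using pos by simp
      fix x :: "'n \<times> bool \<Rightarrow> real"
      assume "x \<in> cell"
      show "\<exists>i. ?g x0 / CARD('n) \<le> (norm (f i x))\<^sup>2"
      proof (rule ccontr)
        assume "\<nexists>i. ?g x0 / CARD('n) \<le> (norm (f i x))\<^sup>2"
        then have "?g x < (\<Sum>i\<in>(UNIV :: 'n set). ?g x0 / CARD('n))"
          by (intro sum_strict_mono) (auto simp: not_le)
        with x0(2)[OF \<open>x \<in> cell\<close>] show False
          by simp
      qed
    qed
  qed
  define q where "q = 1 - c"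
  have q: "0 \<le> q" "q < 1"
  proof -
    obtain i x where "x \<in> cell" "c \<le> (norm (f i x))\<^sup>2"
      using c(2)[OF zero_in_cell] zero_in_cell by blast
    then show "0 \<le> q"
      using \<rho>[of x i] norm_ge_zero[of "1 - \<rho> i x"] by (simp add: q_def)
  qed (use c in \<open>simp add: q_def\<close>)
  define A where "A = range \<rho> \<union> range (\<lambda>(i, b). \<alpha> i b) \<union> range (\<lambda>(i, b). \<omega> i b)
    \<union> range (\<lambda>(a, i). pd a (\<rho> i)) \<union> range (\<lambda>(a, i, b). pd a (\<alpha> i b)) \<union> range (\<lambda>(a, i, b). pd a (\<omega> i b))"
  have "finite A"
    unfolding A_def by simp
  moreover have "trigpoly g" if "g \<in> A" for g
    using that unfolding A_def by (auto intro: trigpolys trigpoly_pd)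
  ultimately obtain C where C1: "C \<ge> 1" and C: "\<And>g x. g \<in> A \<Longrightarrow> x \<in> cell \<Longrightarrow> norm (g x) \<le> C"
    using trigpoly_family_bounded by blast
  have bd: "norm (\<alpha> i b x) \<le> C" "norm (\<omega> i b x) \<le> C" "norm (pd a (\<rho> i) x) \<le> C"
    "norm (pd a (\<alpha> i b) x) \<le> C" "norm (pd a (\<omega> i b) x) \<le> C" if "x \<in> cell" for a b i x
  proof -
    have "\<alpha> i b \<in> A" "\<omega> i b \<in> A" "pd a (\<rho> i) \<in> A" "pd a (\<alpha> i b) \<in> A" "pd a (\<omega> i b) \<in> A"
      using rangeI[of "\<lambda>(i, b). \<alpha> i b" "(i, b)"] rangeI[of "\<lambda>(i, b). \<omega> i b" "(i, b)"]
        rangeI[of "\<lambda>(a, i). pd a (\<rho> i)" "(a, i)"] rangeI[of "\<lambda>(a, i, b). pd a (\<alpha> i b)" "(a, i, b)"]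
        rangeI[of "\<lambda>(a, i, b). pd a (\<omega> i b)" "(a, i, b)"]
      unfolding A_def Un_iff prod.case by iprover+
    then show "norm (\<alpha> i b x) \<le> C" "norm (\<omega> i b x) \<le> C" "norm (pd a (\<rho> i) x) \<le> C"
      "norm (pd a (\<alpha> i b) x) \<le> C" "norm (pd a (\<omega> i b) x) \<le> C"
      using C that by blast+
  qed
  \<comment> \<open>A crude bound for both estimates below: the first needs four terms of size at
    most \<open>(real m + 2)\<^sup>2 * C\<^sup>2\<close>, the second needs 2 + 2 + 2 = 6.\<close>
  define K where "K m = 6 * C\<^sup>2 * (real m + 2)\<^sup>2" for m
  have K_eq: "K m = 6 * ((real m + 2)\<^sup>2 * C\<^sup>2)" for m
    by (simp add: K_def)
  have CC: "C \<le> C\<^sup>2"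
    using C1 by (simp add: power2_eq_square)
  have pow: "norm ((1 - \<rho> i x) ^ m) \<le> 1" if "x \<in> cell" for i x m
    using \<rho>[OF that, of i] small[OF that, of i]
    by (simp add: norm_power power_le_one power2_eq_square mult_le_one)
  have norm_Suc: "norm (of_nat (Suc m) :: complex) = real m + 1" for m
    unfolding norm_of_nat by simp
  \<comment> \<open>The exponent \<open>Suc m\<close> makes the truncated difference
    \<open>Suc m - 1\<close> in the derivatives equal to \<open>m\<close>. This bound holds on the
    whole cell and is only polynomial in \<open>m\<close>.\<close>
  have B: "norm (pd a (\<gamma> (Suc m) i b) x) \<le> K m" if x: "x \<in> cell" for a b i x m
  proof -
    let ?m = "real m + 1"
    have P: "norm (P (Suc m) i x) \<le> 1"
      unfolding P_def by (rule pow[OF x])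
    have H: "norm (H (Suc m) i x) \<le> ?m"
    proof -
      have "norm (H (Suc m) i x) \<le> (\<Sum>k<Suc m. 1)"
        unfolding H_def by (intro sum_norm_le pow x)
      then show ?thesis
        by simp
    qed
    have dP: "norm (pd a (P (Suc m) i) x) \<le> ?m * C"
    proof -
      have "norm (of_nat (Suc m) * (1 - \<rho> i x) ^ m) \<le> ?m * 1"
        unfolding norm_mult norm_Suc by (intro mult_mono pow x) auto
      then show ?thesis
        unfolding pd_P norm_mult[of "- _"] norm_minus_cancel
        by (intro mult_mono bd x) (auto simp del: of_nat_Suc)
    qed
    have dH: "norm (pd a (H (Suc m) i) x) \<le> ?m\<^sup>2 * C"
    proof -
      have "norm (of_nat k * (1 - \<rho> i x) ^ (k - 1)) \<le> ?m * 1" if "k < Suc m" for k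
        unfolding norm_mult by (intro mult_mono pow x) (use that in auto)
      then have "norm (\<Sum>k<Suc m. of_nat k * (1 - \<rho> i x) ^ (k - 1)) \<le> (\<Sum>k<Suc m. ?m * 1)"
        by (intro sum_norm_le) auto
      then have "norm (\<Sum>k<Suc m. of_nat k * (1 - \<rho> i x) ^ (k - 1)) \<le> ?m\<^sup>2"
        by (simp add: power2_eq_square algebra_simps)
      then show ?thesis
        unfolding pd_H norm_mult[of "- _"] norm_minus_cancel
        by (intro mult_mono bd x) auto
    qed
    have m: "1 \<le> ?m\<^sup>2" "?m \<le> ?m\<^sup>2"
      by (auto simp: power2_eq_square algebra_simps)
    have "norm (pd a (\<gamma> (Suc m) i b) x) \<le>
        norm (P (Suc m) i x * pd a (\<alpha> i b) x) + norm (pd a (P (Suc m) i) x * \<alpha> i b x)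
        + norm (H (Suc m) i x * pd a (\<omega> i b) x) + norm (pd a (H (Suc m) i) x * \<omega> i b x)"
      unfolding pd_\<gamma> by (intro order_trans[OF norm_triangle_ineq] add_mono order_refl)
    also have "\<dots> \<le> 1 * C + (?m * C) * C + ?m * C + (?m\<^sup>2 * C) * C"
      unfolding norm_mult using C1 by (intro add_mono mult_mono P H dP dH bd x) auto
    also have "\<dots> \<le> ?m\<^sup>2 * C\<^sup>2 + ?m\<^sup>2 * C\<^sup>2 + ?m\<^sup>2 * C\<^sup>2 + ?m\<^sup>2 * C\<^sup>2"
    proof -
      have "1 * C \<le> ?m\<^sup>2 * C\<^sup>2"
        using C1 by (intro mult_mono m CC) auto
      moreover have "(?m * C) * C \<le> ?m\<^sup>2 * C\<^sup>2"
        using mult_right_mono[OF m(2), of "C\<^sup>2"] by (simp add: power2_eq_square mult_ac)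
      moreover have "?m * C \<le> ?m\<^sup>2 * C\<^sup>2"
        using C1 by (intro mult_mono m CC) auto
      moreover have "(?m\<^sup>2 * C) * C \<le> ?m\<^sup>2 * C\<^sup>2"
        by (simp add: power2_eq_square)
      ultimately show ?thesis
        by (intro add_mono)
    qed
    also have "\<dots> \<le> K m"
    proof -
      have "?m\<^sup>2 * C\<^sup>2 \<le> (real m + 2)\<^sup>2 * C\<^sup>2"
        by (intro mult_right_mono power_mono) auto
      moreover have "0 \<le> (real m + 2)\<^sup>2 * C\<^sup>2"
        by simp
      ultimately show ?thesis
        unfolding K_eq by linarith
    qed
    finally show ?thesis .
  qed
  \<comment> \<open>Where \<open>f i\<close> is bounded away from 0, each term of
    \<open>d\<gamma>_eq\<close> contributes a factor of at most \<open>q ^ m\<close>.\<close>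
  have \<Omega>: "norm (pd a (\<gamma> (Suc m) i b) x - pd b (\<gamma> (Suc m) i a) x) \<le> K m * q ^ m"
    if x: "x \<in> cell" and i: "c \<le> (norm (f i x))\<^sup>2" for a b i x m
  proof -
    let ?m = "real m + 1"
    have "norm (1 - \<rho> i x) \<le> q"
      using \<rho>[OF x, of i] i by (simp add: q_def)
    then have z: "norm ((1 - \<rho> i x) ^ m) \<le> q ^ m"
      by (simp add: norm_power power_mono)
    have P: "norm (P (Suc m) i x) \<le> q ^ m"
    proof -
      have "norm (P (Suc m) i x) = norm ((1 - \<rho> i x) ^ 1) * norm ((1 - \<rho> i x) ^ m)"
        by (simp add: P_def norm_mult)
      also have "\<dots> \<le> 1 * q ^ m"
        by (intro mult_mono pow z x) auto
      finally show ?thesis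
        by simp
    qed
    have mz: "norm (of_nat (Suc m) * (1 - \<rho> i x) ^ (Suc m - 1)) \<le> ?m * q ^ m"
      unfolding norm_mult norm_Suc diff_Suc_1 by (intro mult_mono z) auto
    have d\<alpha>: "norm (pd a (\<alpha> i b) x - pd b (\<alpha> i a) x) \<le> C + C"
      by (rule order_trans[OF norm_triangle_ineq4]) (intro add_mono bd x)
    have d\<omega>: "norm (pd a (\<omega> i b) x - pd b (\<omega> i a) x) \<le> C + C"
      by (rule order_trans[OF norm_triangle_ineq4]) (intro add_mono bd x)
    have \<rho>\<alpha>: "norm (pd a (\<rho> i) x * \<alpha> i b x - pd b (\<rho> i) x * \<alpha> i a x) \<le> C * C + C * C"
      by (rule order_trans[OF norm_triangle_ineq4], unfold norm_mult)
        (use C1 in \<open>intro add_mono mult_mono bd x; simp\<close>)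
    have "norm (pd a (\<gamma> (Suc m) i b) x - pd b (\<gamma> (Suc m) i a) x) \<le>
      norm (P (Suc m) i x) * norm (pd a (\<alpha> i b) x - pd b (\<alpha> i a) x)
      + norm (of_nat (Suc m) * (1 - \<rho> i x) ^ (Suc m - 1)) * norm (pd a (\<rho> i) x * \<alpha> i b x - pd b (\<rho> i) x * \<alpha> i a x)
      + norm (of_nat (Suc m) * (1 - \<rho> i x) ^ (Suc m - 1)) * norm (pd a (\<omega> i b) x - pd b (\<omega> i a) x)"
      unfolding d\<gamma>_eq norm_mult[symmetric]
      by (intro order_trans[OF norm_triangle_ineq] order_trans[OF norm_triangle_ineq4] add_mono order_refl)
    also have "\<dots> \<le> q ^ m * (C + C) + (?m * q ^ m) * (C * C + C * C) + (?m * q ^ m) * (C + C)"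
      using C1 q by (intro add_mono mult_mono P mz d\<alpha> d\<omega> \<rho>\<alpha>) auto
    also have "\<dots> = q ^ m * (2 * C + 2 * (?m * C\<^sup>2) + 2 * (?m * C))"
      by (simp add: algebra_simps power2_eq_square)
    also have "\<dots> \<le> q ^ m * K m"
    proof (intro mult_left_mono)
      have "1 * C \<le> (real m + 2)\<^sup>2 * C\<^sup>2" "?m * C \<le> (real m + 2)\<^sup>2 * C\<^sup>2" "?m * C\<^sup>2 \<le> (real m + 2)\<^sup>2 * C\<^sup>2"
        using C1 by (intro mult_mono CC order_refl; simp add: power2_eq_square algebra_simps)+
      then show "2 * C + 2 * (?m * C\<^sup>2) + 2 * (?m * C) \<le> K m"
        unfolding K_eq by linarith
    qed (use q in simp)
    finally show ?thesis
      by (simp add: mult.commute)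
  qed
  define N where "N = real (card {p. p permutes (UNIV :: ('n \<times> bool) set)})"
  have K0: "0 \<le> K m" for m
    by (simp add: K_def)
  have dens: "norm (density (\<lambda>k. Suc m) x) \<le> N * (K m ^ CARD('n) * q ^ m)" if x: "x \<in> cell" for x m
  proof -
    obtain i where i: "c \<le> (norm (f i x))\<^sup>2"
      using c(2)[OF x] by blast
    \<comment> \<open>The harmless factor 2 gives access to the antisymmetrized form, with the slot
      \<open>i\<close> chosen according to the point \<open>x\<close>.\<close>
    have "norm (density (\<lambda>k. Suc m) x) \<le> norm (2 * density (\<lambda>k. Suc m) x)"
      by (simp add: norm_mult)
    also have "\<dots> \<le> (\<Sum>p | p permutes (UNIV :: ('n \<times> bool) set). K m ^ CARD('n) * q ^ m)"
      unfolding density_antisymmetrized[of _ _ i]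
    proof (rule sum_norm_le)
      fix p :: "'n \<times> bool \<Rightarrow> 'n \<times> bool"
      let ?R = "\<Prod>k\<in>UNIV - {i}. pd (p (k, False)) (\<gamma> (Suc m) k (p (k, True))) x"
      let ?d = "pd (p (i, False)) (\<gamma> (Suc m) i (p (i, True))) x - pd (p (i, True)) (\<gamma> (Suc m) i (p (i, False))) x"
      have "norm ?R \<le> (\<Prod>k\<in>UNIV - {i}. K m)"
        unfolding prod_norm[symmetric] by (intro prod_mono conjI norm_ge_zero B x)
      then have R: "norm ?R \<le> K m ^ (CARD('n) - 1)"
        by (simp add: card_Diff_singleton)
      have "norm (of_int (sign p) * (?d * ?R)) = norm ?d * norm ?R"
        by (simp add: norm_mult sign_def)
      also have "\<dots> \<le> (K m * q ^ m) * K m ^ (CARD('n) - 1)"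
        using K0 q by (intro mult_mono \<Omega>[OF x i] R) auto
      also have "\<dots> = K m ^ CARD('n) * q ^ m"
        by (simp add: power_eq_if[of _ "CARD('n)"])
      finally show "norm (of_int (sign p) * (?d * ?R)) \<le> K m ^ CARD('n) * q ^ m" .
    qed
    finally show ?thesis
      by (simp add: N_def)
  qed
  let ?V = "measure cell_measure (cell :: ('n \<times> bool \<Rightarrow> real) set)"
  have integral_0: "(\<integral>x. density (\<lambda>k. 0) x \<partial>cell_measure) = ?V *\<^sub>R of_int (permanent \<sigma>)"
    by (simp add: density_0 space_cell_measure)
  \<comment> \<open>The left side does not depend on \<open>m\<close>, while the right side tends to
    0.\<close>
  have "norm (?V *\<^sub>R of_int (permanent \<sigma>) :: complex) \<le>
      ?V * N * (6 * C\<^sup>2) ^ CARD('n) * ((real m + 2) ^ (2 * CARD('n)) * q ^ m)" for m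
  proof -
    have "norm (?V *\<^sub>R of_int (permanent \<sigma>) :: complex) = norm (\<integral>x. density (\<lambda>k. Suc m) x \<partial>cell_measure)"
      unfolding integral_density_eq[of "\<lambda>k. Suc m"] integral_0 ..
    also have "\<dots> \<le> (\<integral>x. norm (density (\<lambda>k. Suc m) x) \<partial>cell_measure)"
      by (rule integral_norm_bound)
    also have "\<dots> \<le> (\<integral>x. N * (K m ^ CARD('n) * q ^ m) \<partial>(cell_measure :: ('n \<times> bool \<Rightarrow> real) measure))"
      by (intro integral_mono integrable_norm trigpoly_integrable trigpoly_density)
        (auto simp: space_cell_measure dens)
    also have "\<dots> = ?V * N * (6 * C\<^sup>2) ^ CARD('n) * ((real m + 2) ^ (2 * CARD('n)) * q ^ m)"
      by (simp add: space_cell_measure K_def power_mult_distrib power_mult)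
    finally show ?thesis .
  qed
  moreover have "(\<lambda>m. ?V * N * (6 * C\<^sup>2) ^ CARD('n) * ((real m + 2) ^ (2 * CARD('n)) * q ^ m)) \<longlonglongrightarrow>
      ?V * N * (6 * C\<^sup>2) ^ CARD('n) * 0"
    using q by (intro tendsto_mult_left polynomial_times_geometric_tendsto_0) simp_all
  ultimately have "norm (?V *\<^sub>R of_int (permanent \<sigma>) :: complex) \<le> ?V * N * (6 * C\<^sup>2) ^ CARD('n) * 0"
    by (intro LIMSEQ_le_const) auto
  then show ?thesis
    using measure_cell_pos[where 'n = 'n] by (simp add: mult_le_0_iff)
qed

end

subsection \<open>Product vectors\<close>

text \<open>An unnormalized representative of a point of the Bloch sphere, chosen polynomial in the
  radius. At radius 0 the angle has no effect and at radius 1 it is only a phase, so the square of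
  radius and angle closes up to a sphere.\<close>

definition bloch :: "('n \<times> bool \<Rightarrow> real) \<Rightarrow> 'n \<Rightarrow> complex ^ 2" where
  "bloch x j = (\<chi> k. if k = 1 then of_real (1 - x (j, False))
    else of_real (x (j, False)) * cis (x (j, True)))"

lemma prod_vec_bloch_nonzero: "prod_vec (bloch x) \<noteq> 0"
proof -
  \<comment> \<open>A basis state with nonzero amplitude: the second coordinate is taken where the
    radius is nonzero, and elsewhere the first coordinate is 1.\<close>
  let ?s = "{j. x (j, False) \<noteq> 0}"
  have "bloch x j $ (if j \<in> ?s then 2 else 1) \<noteq> 0" for j
    by (simp add: bloch_def)
  then have "prod_vec (bloch x) $ ?s \<noteq> 0"
    unfolding prod_vec_def by simp
  then show ?thesis
    by auto
qed

text \<open>The factor of qubit \<open>j\<close> in the amplitude of the basis state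
  \<open>s\<close> after conjugation on \<open>T\<close>; conjugation only negates the
  frequency.\<close>

definition bloch_monomial :: "'n set \<Rightarrow> 'n set \<Rightarrow> 'n \<Rightarrow> ('n \<times> bool \<Rightarrow> real) \<Rightarrow> complex" where
  "bloch_monomial T s j x = (if j \<in> s
    then of_real (x (j, False)) * cis (of_int (if j \<in> T then -1 else 1) * x (j, True))
    else 1 - of_real (x (j, False)))"

lemma cinner_prod_vec_bloch:
  "cinner \<phi> (prod_vec (partial_conj T (bloch x))) =
    (\<Sum>s\<in>UNIV. cnj (\<phi> $ s) * (\<Prod>j\<in>UNIV. bloch_monomial T s j x))"
proof -
  have "partial_conj T (bloch x) j $ (if j \<in> s then 2 else 1) = bloch_monomial T s j x" for s j
    by (auto simp: partial_conj_def bloch_def bloch_monomial_def cis_cnj)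
  then show ?thesis
    by (simp add: cinner_def prod_vec_def)
qed

lemma trigpoly_bloch_monomial: "trigpoly (bloch_monomial T s j)"
proof (cases "j \<in> s")
  case True
  have "trigpoly (\<lambda>x. of_real (x (j, False)) * cis (of_int (if j \<in> T then -1 else 1) * x (j, True)))"
    by (intro trigpoly_intros)
  with True show ?thesis
    by (simp add: bloch_monomial_def[abs_def])
next
  case False
  have "trigpoly (\<lambda>x. 1 - of_real (x (j, False)))"
    by (intro trigpoly_intros)
  with False show ?thesis
    by (simp add: bloch_monomial_def[abs_def])
qed

lemma pd_bloch_monomial:
  "pd (j, True) (bloch_monomial T s l) x =
    (if l = j \<and> j \<in> s then \<i> * of_int (if j \<in> T then -1 else 1) * bloch_monomial T s j x else 0)"
proof -
  let ?e = "if l \<in> T then -1 else 1 :: int"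
  have "pd (j, True) (\<lambda>x. of_real (x (l, False)) * cis (of_int ?e * x (l, True))) x =
      (if l = j then \<i> * of_int ?e * (of_real (x (l, False)) * cis (of_int ?e * x (l, True))) else 0)"
    by (subst pd_mult[OF trigpoly.radius trigpoly.angle]) (simp add: pd_radius pd_cis[of _ "of_int ?e"])
  moreover have "pd (j, True) (\<lambda>x. 1 - complex_of_real (x (l, False))) x = 0"
    by (subst pd_diff) (auto intro: trigpoly_intros simp: pd_radius)
  ultimately show ?thesis
    unfolding bloch_monomial_def by (cases "l \<in> s") auto
qed

text \<open>Only the monomials with \<open>j \<in> s\<close> depend on the angle of
  \<open>j\<close>. At radius 0 these vanish, and at radius 1 all the others vanish, so on either
  face every monomial satisfies the same rotation equation.\<close>

lemma pd_bloch_section: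
  fixes T :: "'n::finite set"
  assumes x: "x (j, False) \<in> {0, 1}"
  shows "pd (j, True) (\<lambda>x. cinner \<phi> (prod_vec (partial_conj T (bloch x)))) x =
    \<i> * of_int (if j \<in> T then -1 else 1) * of_real (x (j, False)) * cinner \<phi> (prod_vec (partial_conj T (bloch x)))"
proof -
  let ?e = "if j \<in> T then -1 else 1 :: int"
  let ?B = "\<lambda>s x. \<Prod>l\<in>UNIV. bloch_monomial T s l x"
  have B: "trigpoly (?B s)" for s
    by (intro trigpoly_intros trigpoly_bloch_monomial)
  have "pd (j, True) (?B s) x = \<i> * of_int ?e * of_real (x (j, False)) * ?B s x" for s
  proof -
    have "pd (j, True) (?B s) x = (\<Sum>l\<in>UNIV. pd (j, True) (bloch_monomial T s l) x *
        (\<Prod>l'\<in>UNIV - {l}. bloch_monomial T s l' x))"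
      by (intro pd_prod trigpoly_bloch_monomial) simp
    also have "\<dots> = (\<Sum>l\<in>UNIV. if l = j then pd (j, True) (bloch_monomial T s j) x *
        (\<Prod>l'\<in>UNIV - {j}. bloch_monomial T s l' x) else 0)"
      by (intro sum.cong) (auto simp: pd_bloch_monomial)
    also have "\<dots> = pd (j, True) (bloch_monomial T s j) x * (\<Prod>l'\<in>UNIV - {j}. bloch_monomial T s l' x)"
      by simp
    also have "pd (j, True) (bloch_monomial T s j) x =
        \<i> * of_int ?e * of_real (x (j, False)) * bloch_monomial T s j x"
      using x unfolding pd_bloch_monomial by (auto simp: bloch_monomial_def)
    also have "\<dots> * (\<Prod>l'\<in>UNIV - {j}. bloch_monomial T s l' x) =
        \<i> * of_int ?e * of_real (x (j, False)) * ?B s x"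
      by (simp add: prod.remove[of UNIV j])
    finally show ?thesis .
  qed
  moreover have "pd (j, True) (\<lambda>x. \<Sum>s\<in>UNIV. cnj (\<phi> $ s) * ?B s x) x =
      (\<Sum>s\<in>UNIV. cnj (\<phi> $ s) * pd (j, True) (?B s) x)"
    by (subst pd_sum) (intro trigpoly_intros B, simp add: pd_cmult B)
  ultimately show ?thesis
    unfolding cinner_prod_vec_bloch by (simp add: sum_distrib_left mult_ac)
qed

lemma common_zero_of_permanent_nonzero:
  fixes S :: "'n::finite \<Rightarrow> 'n set" and \<phi> :: "'n \<Rightarrow> 'n qstate"
  assumes "permanent (sign_matrix S) \<noteq> 0"
  shows "\<exists>\<psi>. prod_vec \<psi> \<noteq> 0 \<and> (\<forall>i. cinner (\<phi> i) (prod_vec (partial_conj (S i) \<psi>)) = 0)"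
proof (rule ccontr)
  assume contra: "\<not> ?thesis"
  define F where "F i x = cinner (\<phi> i) (prod_vec (partial_conj (S i) (bloch x)))" for i x
  have F: "trigpoly (F i)" for i
    unfolding F_def cinner_prod_vec_bloch by (intro trigpoly_intros trigpoly_bloch_monomial)
  \<comment> \<open>Division by a common bound \<open>C \<ge> 1\<close> brings the sections into the
    unit disc without changing their zeros.\<close>
  obtain C where C: "C \<ge> 1" "\<And>i x. x \<in> cell \<Longrightarrow> norm (F i x) \<le> C"
  proof (rule trigpoly_family_bounded[of "range F"])
    show "finite (range F)"
      by simp
    show "trigpoly g" if "g \<in> range F" for g
      using that F by auto
  qed blast
  interpret line_sections "\<lambda>i x. of_real (1 / C) * F i x" "sign_matrix S"
  proof
    show "trigpoly (\<lambda>x. of_real (1 / C) * F i x)" for i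
      by (intro trigpoly_intros F)
    show "pd (j, True) (\<lambda>x. of_real (1 / C) * F i x) x =
        \<i> * of_int (sign_matrix S i j) * of_real (x (j, False)) * (of_real (1 / C) * F i x)"
      if "x (j, False) \<in> {0, 1}" for i j x
      using pd_bloch_section[of x j "\<phi> i" "S i", OF that]
      unfolding pd_cmult[OF F] by (simp add: F_def[abs_def] sign_matrix_def)
  qed
  have "permanent (sign_matrix S) = 0"
  proof (rule permanent_eq_0_of_no_common_zero)
    show "norm (of_real (1 / C) * F i x) \<le> 1" if "x \<in> cell" for i x
      using C(1) C(2)[OF that, of i] by (simp add: norm_mult norm_divide divide_simps)
    show "\<exists>i. of_real (1 / C) * F i x \<noteq> 0" for x
      using contra prod_vec_bloch_nonzero[of x] C(1) by (auto simp: F_def)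
  qed
  with assms show False ..
qed

section \<open>Membership in \<open>D\<close> as a single linear equation\<close>

lemma kernel_subset_of_dim_orth_compl_1:
  fixes D :: "(complex ^ 'k::finite) set"
  assumes D: "vec.subspace D" and dim: "vec.dim (orth_compl D) = 1"
  obtains \<phi> where "\<And>w. cinner \<phi> w = 0 \<Longrightarrow> w \<in> D"
proof -
  have inner_eq: "v \<bullet> w = Re (cinner v w)" for v w :: "complex ^ 'k"
    by (simp add: inner_vec_def cinner_def inner_complex_def)
  have cinner_smult: "cinner (c *s v) w = cnj c * cinner v w" for c and v w :: "complex ^ 'k"
    by (simp add: cinner_def sum_distrib_left mult_ac)
  have real_D: "subspace D"
    unfolding subspace_def
  proof (intro conjI ballI allI)
    show "0 \<in> D" "\<And>x y. x \<in> D \<Longrightarrow> y \<in> D \<Longrightarrow> x + y \<in> D"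
      using D by (auto simp: vec.subspace_def)
    show "r *\<^sub>R x \<in> D" if "x \<in> D" for r x
    proof -
      have "r *\<^sub>R x = of_real r *s x"
        by (simp add: vec_eq_iff scaleR_vec_def vector_scalar_mult_def scaleR_conv_of_real[where 'a = complex])
      then show ?thesis
        using D that by (auto simp: vec.subspace_def)
    qed
  qed
  \<comment> \<open>The real inner product is the real part of \<open>cinner\<close>. Since
    \<open>D\<close> is closed under multiplication by the imaginary unit, real orthogonality to
    \<open>D\<close> also kills the imaginary part.\<close>
  have compl: "orthogonal_comp D \<subseteq> orth_compl D"
  proof
    fix w assume "w \<in> orthogonal_comp D"
    then have Re: "Re (cinner v w) = 0" if "v \<in> D" for v
      using that by (simp add: orthogonal_comp_def orthogonal_def inner_eq[symmetric])
    have "cinner v w = 0" if "v \<in> D" for v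
    proof -
      have "\<i> *s v \<in> D"
        using D that by (auto simp: vec.subspace_def)
      from Re[OF this] Re[OF that] show ?thesis
        by (simp add: cinner_smult complex_eq_iff)
    qed
    then show "w \<in> orth_compl D"
      by (simp add: orth_compl_def)
  qed
  obtain B where B: "B \<subseteq> orth_compl D" "orth_compl D \<subseteq> vec.span B" "card B = 1"
    using vec.basis_exists[of "orth_compl D"] dim by metis
  then obtain \<phi> where \<phi>: "B = {\<phi>}"
    by (auto simp: card_1_singleton_iff)
  show ?thesis
  proof (rule that)
    fix w assume w: "cinner \<phi> w = 0"
    \<comment> \<open>The complement is spanned by \<phi>, so \<open>w\<close> is orthogonal to all
      of it, and the real double complement of \<open>D\<close> is \<open>D\<close> itself.\<close>
    have "w \<in> orthogonal_comp (orthogonal_comp D)"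
      unfolding orthogonal_comp_def[of "orthogonal_comp D"] mem_Collect_eq
    proof
      fix u assume "u \<in> orthogonal_comp D"
      then obtain c where "u = c *s \<phi>"
        using compl B(2) \<phi> by (auto simp: vec.span_singleton)
      then show "orthogonal u w"
        using w by (simp add: orthogonal_def inner_eq cinner_smult)
    qed
    then show "w \<in> D"
      by (simp add: orthogonal_comp_self[OF real_D])
  qed
qed

theorem theorem3p1:
  fixes S :: "'n::finite \<Rightarrow> 'n set"
    and D :: "'n \<Rightarrow> 'n qstate set"
  assumes "\<And>i. vec.subspace (D i)"
    and "\<And>i. vec.dim (orth_compl (D i)) = 1"
    and "permanent (sign_matrix S) \<noteq> 0"
  shows "\<exists>\<psi>. prod_vec \<psi> \<noteq> 0 \<and> (\<forall>i. prod_vec (partial_conj (S i) \<psi>) \<in> D i)"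
proof -
  have "\<exists>\<phi>. \<forall>w. cinner \<phi> w = 0 \<longrightarrow> w \<in> D i" for i
    using kernel_subset_of_dim_orth_compl_1[OF assms(1,2)] by metis
  then obtain \<phi> where "\<And>i w. cinner (\<phi> i) w = 0 \<Longrightarrow> w \<in> D i"
    by metis
  then show ?thesis
    using common_zero_of_permanent_nonzero[OF assms(3), of \<phi>] by blast
qed

end
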